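(* Let $X$ be a locally compact Hausdorff space and let $A$ be a Banach algebra with $\Delta(A)\neq\emptyset$. (1) The following assertions are equivalent: (a) $C_b(X,A)$ is contractible; (b) $C_0(X,A)$ is contractible; (c) $X$ is finite and $A$ is contractible. (2) The following assertions are equivalent: (a) $C_b(X,A)^{**}$ is contractible; (b) $C_0(X,A)^{**}$ is contractible; (c) $X$ is finite and $A^{**}$ is contractible.
   Context: $\Delta(A)$ is the character space of $A$ (non-zero multiplicative linear functionals). $C_b(X,A)$ (resp. $C_0(X,A)$) is the Banach algebra of bounded continuous functions (resp. continuous functions vanishing at infinity) from $X$ into $A$, with pointwise operations and the supremum norm. Second duals carry the (first) Arens product. A derivation from a Banach algebra $B$ into a Banach $B$-bimodule $E$ is a bounded linear map $D$ with $D(ab)=D(a)b+aD(b)$; it is inner if there is $z\in E$ with $D(a)=za-az$ for all $a\in B$. $B$ is contractible if every continuous derivation from $B$ into any Banach $B$-bimodule is inner. *)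

theory Defs
  imports "HOL-Analysis.Analysis"
begin

section \<open>Complex Banach algebras\<close>

text \<open>
  The library's normed type classes only carry real scalars.  Complex structures are obtained by
  adding a complex scalar multiplication that extends the real one.  Algebras are not assumed to
  be unital or commutative.
\<close>

class complex_normed_vector = real_normed_vector +
  fixes scaleC :: "complex \<Rightarrow> 'a \<Rightarrow> 'a" (infixr "*\<^sub>C" 75)
  assumes scaleC_add_right: "c *\<^sub>C (x + y) = c *\<^sub>C x + c *\<^sub>C y"
    and scaleC_add_left: "(c + d) *\<^sub>C x = c *\<^sub>C x + d *\<^sub>C x"
    and scaleC_scaleC: "c *\<^sub>C d *\<^sub>C x = (c * d) *\<^sub>C x"
    and scaleC_of_real: "complex_of_real r *\<^sub>C x = r *\<^sub>R x"
    and norm_scaleC: "norm (c *\<^sub>C x) = norm c * norm x"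

class complex_normed_algebra = complex_normed_vector + real_normed_algebra +
  assumes mult_scaleC_left: "(c *\<^sub>C x) * y = c *\<^sub>C (x * y)"
    and mult_scaleC_right: "x * (c *\<^sub>C y) = c *\<^sub>C (x * y)"

class complex_banach_algebra = complex_normed_algebra + banach

lemma scaleC_one: "1 *\<^sub>C (x::'a::complex_normed_vector) = x"
  using scaleC_of_real[of 1 x] by simp

lemma scaleC_minus_one: "(-1) *\<^sub>C (x::'a::complex_normed_vector) = - x"
  using scaleC_of_real[of "-1" x] by simp

lemma scaleC_zero_right: "c *\<^sub>C (0::'a::complex_normed_vector) = 0"
  using scaleC_add_right[of c "0::'a" 0] by simp

lemma scaleC_minus_right: "c *\<^sub>C (- x) = - (c *\<^sub>C (x::'a::complex_normed_vector))"
  using scaleC_add_right[of c x "-x"] by (simp add: scaleC_zero_right minus_unique)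

lemma scaleC_diff_right: "c *\<^sub>C (x - y) = c *\<^sub>C x - c *\<^sub>C (y::'a::complex_normed_vector)"
  using scaleC_add_right[of c x "-y"] by (simp add: scaleC_minus_right)

lemma scaleC_scaleR: "c *\<^sub>C r *\<^sub>R x = r *\<^sub>R c *\<^sub>C (x::'a::complex_normed_vector)"
  by (metis scaleC_of_real scaleC_scaleC mult.commute)

lemma bounded_linear_scaleC: "bounded_linear (\<lambda>x::'a::complex_normed_vector. c *\<^sub>C x)"
  by (rule bounded_linear_intro[where K="norm c"])
     (simp_all add: scaleC_add_right scaleC_scaleR norm_scaleC mult.commute)

definition character_space :: "('a::complex_banach_algebra \<Rightarrow> complex) set" where
  "character_space = {\<phi>. (\<forall>a b. \<phi> (a + b) = \<phi> a + \<phi> b) \<and> (\<forall>c a. \<phi> (c *\<^sub>C a) = c * \<phi> a) \<and>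
     (\<forall>a b. \<phi> (a * b) = \<phi> a * \<phi> b) \<and> (\<exists>a. \<phi> a \<noteq> 0)}"


section \<open>The algebra of bounded continuous functions\<close>

text \<open>
  The library type of bounded continuous functions carries the supremum norm; its completeness is
  available there only for metric domains and is extended to topological domains here.
\<close>

instance bcontfun :: (topological_space, complete_space) complete_space
proof
  fix f :: "nat \<Rightarrow> ('a, 'b) bcontfun"
  assume "Cauchy f"
  then obtain g where "uniform_limit UNIV f g sequentially"
    using uniformly_convergent_eq_cauchy[of "\<lambda>_. True" f]
    unfolding Cauchy_def uniform_limit_sequentially_iff
    by (metis dist_fun_lt_imp_dist_val_lt)
  from uniform_limit_bcontfunE[OF this sequentially_bot]
  obtain l' where "g = apply_bcontfun l'" "(f \<longlonglongrightarrow> l')" by metis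
  then show "convergent f"
    by (intro convergentI)
qed

instance bcontfun :: (topological_space, banach) banach ..

instantiation bcontfun :: (topological_space, complex_normed_vector) complex_normed_vector
begin

definition scaleC_bcontfun :: "complex \<Rightarrow> ('a \<Rightarrow>\<^sub>C 'b) \<Rightarrow> 'a \<Rightarrow>\<^sub>C 'b" where
  "scaleC_bcontfun c f = Bcontfun (\<lambda>x. c *\<^sub>C f x)"

lemma apply_bcontfun_scaleC [simp]: "apply_bcontfun (c *\<^sub>C f) x = c *\<^sub>C f x"
proof -
  have "(\<lambda>x. c *\<^sub>C f x) \<in> bcontfun"
    by (rule bcontfun_normI[where b="norm c * norm f"])
       (auto intro!: bounded_linear.continuous_on[OF bounded_linear_scaleC] mult_left_mono norm_bounded
         simp: norm_scaleC)
  then show ?thesis by (simp add: scaleC_bcontfun_def Bcontfun_inverse)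
qed

instance
proof
  fix c d :: complex and r :: real and f g :: "'a \<Rightarrow>\<^sub>C 'b"
  show "c *\<^sub>C (f + g) = c *\<^sub>C f + c *\<^sub>C g" "(c + d) *\<^sub>C f = c *\<^sub>C f + d *\<^sub>C f"
    and sc: "c *\<^sub>C d *\<^sub>C f = (c * d) *\<^sub>C f"
    and "complex_of_real r *\<^sub>C f = r *\<^sub>R f"
    by (auto intro!: bcontfun_eqI simp: scaleC_add_right scaleC_add_left scaleC_scaleC scaleC_of_real)
  have le: "norm (c *\<^sub>C f) \<le> norm c * norm f" for c and f :: "'a \<Rightarrow>\<^sub>C 'b"
    by (rule norm_bound) (auto simp: norm_scaleC intro!: mult_left_mono norm_bounded)
  show "norm (c *\<^sub>C f) = norm c * norm f"
  proof (cases "c = 0")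
    case True
    then show ?thesis using le[of c f] by simp
  next
    case False
    have "inverse c *\<^sub>C c *\<^sub>C f = f"
      using False by (intro bcontfun_eqI) (simp add: scaleC_scaleC scaleC_one)
    then have "norm f \<le> norm (inverse c) * norm (c *\<^sub>C f)"
      using le[of "inverse c" "c *\<^sub>C f"] by simp
    then have "norm c * norm f \<le> norm (c *\<^sub>C f)"
      using False by (simp add: norm_inverse norm_divide field_simps)
    then show ?thesis using le[of c f] by simp
  qed
qed

end

instantiation bcontfun :: (topological_space, complex_normed_algebra) complex_normed_algebra
begin

definition times_bcontfun :: "('a \<Rightarrow>\<^sub>C 'b) \<Rightarrow> ('a \<Rightarrow>\<^sub>C 'b) \<Rightarrow> 'a \<Rightarrow>\<^sub>C 'b" where
  "times_bcontfun f g = Bcontfun (\<lambda>x. f x * g x)"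

lemma apply_bcontfun_times [simp]: "apply_bcontfun (f * g) x = f x * g x"
proof -
  have "(\<lambda>x. f x * g x) \<in> bcontfun"
    by (rule bcontfun_normI[where b="norm f * norm g"])
       (auto intro!: continuous_intros order_trans[OF norm_mult_ineq] mult_mono norm_bounded)
  then show ?thesis by (simp add: times_bcontfun_def Bcontfun_inverse)
qed

instance
proof
  fix f g h :: "'a \<Rightarrow>\<^sub>C 'b" and r :: real and c :: complex
  show "f * g * h = f * (g * h)" "(f + g) * h = f * h + g * h" "f * (g + h) = f * g + f * h"
    "r *\<^sub>R f * g = r *\<^sub>R (f * g)" "f * r *\<^sub>R g = r *\<^sub>R (f * g)"
    "c *\<^sub>C f * g = c *\<^sub>C (f * g)" "f * c *\<^sub>C g = c *\<^sub>C (f * g)"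
    by (auto intro!: bcontfun_eqI simp: algebra_simps mult_scaleC_left mult_scaleC_right)
  show "norm (f * g) \<le> norm f * norm g"
    by (rule norm_bound)
       (auto intro!: order_trans[OF norm_mult_ineq] mult_mono norm_bounded)
qed

end

instance bcontfun :: (topological_space, complex_banach_algebra) complex_banach_algebra ..


section \<open>The algebra of continuous functions vanishing at infinity\<close>

definition vanishes_at_infinity :: "('x::topological_space \<Rightarrow> 'a::real_normed_vector) \<Rightarrow> bool" where
  "vanishes_at_infinity f \<longleftrightarrow> (\<forall>e>0. \<exists>K. compact K \<and> (\<forall>x. x \<notin> K \<longrightarrow> norm (f x) < e))"

text \<open>
  A continuous function vanishing at infinity is bounded, so nothing is lost by carving the type
  out of the bounded continuous functions.
\<close>

lemma vanishes_at_infinity_bcontfun: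
  assumes "continuous_on UNIV f" "vanishes_at_infinity f"
  shows "f \<in> bcontfun"
proof -
  obtain K where K: "compact K" "\<And>x. x \<notin> K \<Longrightarrow> norm (f x) < 1"
    using assms(2) unfolding vanishes_at_infinity_def by (meson zero_less_one)
  have "compact (f ` K)"
    using assms(1) K(1) compact_continuous_image continuous_on_subset by blast
  then obtain B where B: "\<And>x. x \<in> K \<Longrightarrow> norm (f x) \<le> B"
    using compact_imp_bounded by (force simp: bounded_iff)
  show ?thesis
  proof (rule bcontfun_normI[where b="max B 1"])
    show "norm (f x) \<le> max B 1" for x
      using B[of x] K(2)[of x] by (cases "x \<in> K") auto
  qed (rule assms(1))
qed

lemma vanishes_at_infinity_0: "vanishes_at_infinity (\<lambda>_. 0)"
  unfolding vanishes_at_infinity_def using compact_empty by auto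

lemma vanishes_at_infinity_add:
  assumes "vanishes_at_infinity f" "vanishes_at_infinity g"
  shows "vanishes_at_infinity (\<lambda>x. f x + g x)"
  unfolding vanishes_at_infinity_def
proof (intro allI impI)
  fix e :: real assume "e > 0"
  then have "e / 2 > 0" by simp
  then obtain K L where "compact K" "\<And>x. x \<notin> K \<Longrightarrow> norm (f x) < e / 2"
    "compact L" "\<And>x. x \<notin> L \<Longrightarrow> norm (g x) < e / 2"
    using assms unfolding vanishes_at_infinity_def by meson
  then show "\<exists>K. compact K \<and> (\<forall>x. x \<notin> K \<longrightarrow> norm (f x + g x) < e)"
    by (intro exI[of _ "K \<union> L"]) (auto intro: norm_triangle_half_l compact_Un norm_add_less[of _ "e/2" _ "e/2", simplified])
qed

lemma vanishes_at_infinity_bound: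
  assumes "vanishes_at_infinity f" and le: "\<And>x. norm (g x) \<le> B * norm (f x)"
  shows "vanishes_at_infinity g"
  unfolding vanishes_at_infinity_def
proof (intro allI impI)
  fix e :: real assume "e > 0"
  then have "e / (\<bar>B\<bar> + 1) > 0" by (simp add: add_nonneg_pos)
  then obtain K where K: "compact K" "\<And>x. x \<notin> K \<Longrightarrow> norm (f x) < e / (\<bar>B\<bar> + 1)"
    using assms(1) unfolding vanishes_at_infinity_def by meson
  have "norm (g x) < e" if "x \<notin> K" for x
  proof -
    have "norm (g x) \<le> (\<bar>B\<bar> + 1) * norm (f x)"
      by (rule order_trans[OF le]) (auto intro!: mult_right_mono)
    also have "\<dots> < e"
      using K(2)[OF that] by (simp add: field_simps add_nonneg_pos)
    finally show ?thesis .
  qed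
  with K(1) show "\<exists>K. compact K \<and> (\<forall>x. x \<notin> K \<longrightarrow> norm (g x) < e)" by blast
qed

typedef (overloaded) ('x, 'a) c0fun =
  "{f :: 'x::topological_space \<Rightarrow>\<^sub>C 'a::real_normed_vector. vanishes_at_infinity (apply_bcontfun f)}"
  morphisms bcontfun_of_c0fun C0fun
  by (rule exI[of _ 0]) (simp add: vanishes_at_infinity_0)

setup_lifting type_definition_c0fun

instantiation c0fun :: (topological_space, real_normed_vector) real_normed_vector
begin

lift_definition zero_c0fun :: "('a, 'b) c0fun" is 0
  by (simp add: vanishes_at_infinity_0)

lift_definition plus_c0fun :: "('a, 'b) c0fun \<Rightarrow> ('a, 'b) c0fun \<Rightarrow> ('a, 'b) c0fun" is "(+)"
  by (simp add: vanishes_at_infinity_add)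

lift_definition uminus_c0fun :: "('a, 'b) c0fun \<Rightarrow> ('a, 'b) c0fun" is uminus
  by (erule vanishes_at_infinity_bound[where B=1]) simp

lift_definition scaleR_c0fun :: "real \<Rightarrow> ('a, 'b) c0fun \<Rightarrow> ('a, 'b) c0fun" is scaleR
  subgoal for r by (erule vanishes_at_infinity_bound[where B="\<bar>r\<bar>"]) simp
  done

lift_definition norm_c0fun :: "('a, 'b) c0fun \<Rightarrow> real" is norm .

definition minus_c0fun :: "('a, 'b) c0fun \<Rightarrow> ('a, 'b) c0fun \<Rightarrow> ('a, 'b) c0fun"
  where "minus_c0fun f g = f + - g"

definition dist_c0fun :: "('a, 'b) c0fun \<Rightarrow> ('a, 'b) c0fun \<Rightarrow> real"
  where "dist_c0fun f g = norm (f - g)"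

definition uniformity_c0fun :: "(('a, 'b) c0fun \<times> ('a, 'b) c0fun) filter"
  where "uniformity_c0fun = (INF e\<in>{0 <..}. principal {(x, y). dist x y < e})"

definition open_c0fun :: "('a, 'b) c0fun set \<Rightarrow> bool"
  where "open_c0fun S = (\<forall>x\<in>S. \<forall>\<^sub>F (x', y) in uniformity. x' = x \<longrightarrow> y \<in> S)"

definition sgn_c0fun :: "('a, 'b) c0fun \<Rightarrow> ('a, 'b) c0fun"
  where "sgn_c0fun f = scaleR (inverse (norm f)) f"

instance
  apply standard
  unfolding dist_c0fun_def open_c0fun_def sgn_c0fun_def uniformity_c0fun_def minus_c0fun_def
  by (rule refl | (transfer, simp add: algebra_simps norm_triangle_ineq))+

end

lemma bcontfun_of_c0fun_minus:
  "bcontfun_of_c0fun (f - g) = bcontfun_of_c0fun f - bcontfun_of_c0fun g"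
  unfolding minus_c0fun_def plus_c0fun.rep_eq uminus_c0fun.rep_eq by simp

lemma dist_c0fun_eq: "dist f g = dist (bcontfun_of_c0fun f) (bcontfun_of_c0fun g)"
  by (simp add: dist_norm norm_c0fun.rep_eq bcontfun_of_c0fun_minus)

lemma c0fun_limit:
  fixes f :: "nat \<Rightarrow> 'a::topological_space \<Rightarrow>\<^sub>C 'b::real_normed_vector"
  assumes "\<And>n. vanishes_at_infinity (apply_bcontfun (f n))" "f \<longlonglongrightarrow> l"
  shows "vanishes_at_infinity (apply_bcontfun l)"
  unfolding vanishes_at_infinity_def
proof (intro allI impI)
  fix e :: real assume "e > 0"
  then have e: "e / 2 > 0" by simp
  then obtain n where n: "dist (f n) l < e / 2"
    using assms(2) unfolding lim_sequentially by blast
  obtain K where K: "compact K" "\<And>x. x \<notin> K \<Longrightarrow> norm (f n x) < e / 2"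
    using assms(1)[of n] e unfolding vanishes_at_infinity_def by blast
  have "norm (l x) < e" if "x \<notin> K" for x
  proof -
    have "norm (l x) \<le> norm (f n x) + dist (f n x) (l x)"
      by (metis dist_commute dist_norm norm_triangle_sub)
    also have "\<dots> < e"
      using K(2)[OF that] dist_bounded[of "f n" x l] n by linarith
    finally show ?thesis .
  qed
  with K(1) show "\<exists>K. compact K \<and> (\<forall>x. x \<notin> K \<longrightarrow> norm (l x) < e)" by blast
qed

instance c0fun :: (topological_space, banach) banach
proof
  fix X :: "nat \<Rightarrow> ('a, 'b) c0fun"
  assume "Cauchy X"
  then have "Cauchy (\<lambda>n. bcontfun_of_c0fun (X n))"
    unfolding Cauchy_def dist_c0fun_eq .
  then obtain l where l: "(\<lambda>n. bcontfun_of_c0fun (X n)) \<longlonglongrightarrow> l"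
    using Cauchy_convergent convergent_def by blast
  have "vanishes_at_infinity (apply_bcontfun l)"
    using c0fun_limit[OF _ l] bcontfun_of_c0fun by blast
  then have "bcontfun_of_c0fun (C0fun l) = l"
    by (simp add: C0fun_inverse)
  then have "X \<longlonglongrightarrow> C0fun l"
    using l unfolding lim_sequentially dist_c0fun_eq by simp
  then show "convergent X" by (rule convergentI)
qed

instantiation c0fun :: (topological_space, complex_normed_vector) complex_normed_vector
begin

lift_definition scaleC_c0fun :: "complex \<Rightarrow> ('a, 'b) c0fun \<Rightarrow> ('a, 'b) c0fun" is scaleC
  subgoal for c by (erule vanishes_at_infinity_bound[where B="norm c"]) (simp add: norm_scaleC)
  done

instance
  by standard
     (transfer, simp add: scaleC_add_right scaleC_add_left scaleC_scaleC scaleC_of_real norm_scaleC)+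

end

instantiation c0fun :: (topological_space, complex_normed_algebra) complex_normed_algebra
begin

lift_definition times_c0fun :: "('a, 'b) c0fun \<Rightarrow> ('a, 'b) c0fun \<Rightarrow> ('a, 'b) c0fun" is "(*)"
  subgoal for f g
    by (erule vanishes_at_infinity_bound[where f="apply_bcontfun g" and B="norm f"])
       (auto intro!: order_trans[OF norm_mult_ineq] mult_right_mono norm_bounded)
  done

instance
  by standard
     (transfer, simp add: algebra_simps mult_scaleC_left mult_scaleC_right norm_mult_ineq)+

end

instance c0fun :: (topological_space, complex_banach_algebra) complex_banach_algebra ..


section \<open>The dual space\<close>

text \<open>Complex-linear bounded functionals, with the operator norm inherited from the real ones.\<close>

typedef (overloaded) 'a cdual =
  "{f :: 'a::complex_normed_vector \<Rightarrow>\<^sub>L complex. \<forall>c x. blinfun_apply f (c *\<^sub>C x) = c * blinfun_apply f x}"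
  morphisms blinfun_of_cdual Cdual
  by (rule exI[of _ 0]) simp

setup_lifting type_definition_cdual

definition cdual_apply :: "'a::complex_normed_vector cdual \<Rightarrow> 'a \<Rightarrow> complex" where
  "cdual_apply f = blinfun_apply (blinfun_of_cdual f)"

instantiation cdual :: (complex_normed_vector) complex_normed_vector
begin

lift_definition zero_cdual :: "'a cdual" is 0 by simp

lift_definition plus_cdual :: "'a cdual \<Rightarrow> 'a cdual \<Rightarrow> 'a cdual" is "(+)"
  by (simp add: blinfun.add_left algebra_simps)

lift_definition uminus_cdual :: "'a cdual \<Rightarrow> 'a cdual" is uminus
  by (simp add: blinfun.minus_left)

lift_definition scaleR_cdual :: "real \<Rightarrow> 'a cdual \<Rightarrow> 'a cdual" is scaleR
  by (simp add: blinfun.scaleR_left)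

lift_definition scaleC_cdual :: "complex \<Rightarrow> 'a cdual \<Rightarrow> 'a cdual"
  is "\<lambda>c f. blinfun_compose (blinfun_mult_right c) f"
  by simp

lift_definition norm_cdual :: "'a cdual \<Rightarrow> real" is norm .

definition minus_cdual :: "'a cdual \<Rightarrow> 'a cdual \<Rightarrow> 'a cdual"
  where "minus_cdual f g = f + - g"

definition dist_cdual :: "'a cdual \<Rightarrow> 'a cdual \<Rightarrow> real"
  where "dist_cdual f g = norm (f - g)"

definition uniformity_cdual :: "('a cdual \<times> 'a cdual) filter"
  where "uniformity_cdual = (INF e\<in>{0 <..}. principal {(x, y). dist x y < e})"

definition open_cdual :: "'a cdual set \<Rightarrow> bool"
  where "open_cdual S = (\<forall>x\<in>S. \<forall>\<^sub>F (x', y) in uniformity. x' = x \<longrightarrow> y \<in> S)"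

definition sgn_cdual :: "'a cdual \<Rightarrow> 'a cdual"
  where "sgn_cdual f = scaleR (inverse (norm f)) f"

instance
proof
  fix c d :: complex and r s :: real and f g h :: "'a cdual"
  show "f + g + h = f + (g + h)" "f + g = g + f" "0 + f = f" "- f + f = 0"
    "r *\<^sub>R (f + g) = r *\<^sub>R f + r *\<^sub>R g" "(r + s) *\<^sub>R f = r *\<^sub>R f + s *\<^sub>R f"
    "r *\<^sub>R s *\<^sub>R f = (r * s) *\<^sub>R f" "1 *\<^sub>R f = f"
    "(norm f = 0) = (f = 0)" "norm (f + g) \<le> norm f + norm g" "norm (r *\<^sub>R f) = \<bar>r\<bar> * norm f"
    by (transfer, simp add: algebra_simps norm_triangle_ineq)+
  show "f - g = f + - g" "dist f g = norm (f - g)" "sgn f = scaleR (inverse (norm f)) f"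
    by (simp_all add: minus_cdual_def dist_cdual_def sgn_cdual_def)
  show "(uniformity :: ('a cdual \<times> 'a cdual) filter) = (INF e\<in>{0 <..}. principal {(x, y). dist x y < e})"
    by (rule uniformity_cdual_def)
  show "open U = (\<forall>x\<in>U. \<forall>\<^sub>F (x', y) in uniformity. x' = x \<longrightarrow> y \<in> U)" for U :: "'a cdual set"
    by (rule open_cdual_def)
  show "c *\<^sub>C (f + g) = c *\<^sub>C f + c *\<^sub>C g" "(c + d) *\<^sub>C f = c *\<^sub>C f + d *\<^sub>C f"
    and sc: "c *\<^sub>C d *\<^sub>C f = (c * d) *\<^sub>C f"
    and "complex_of_real r *\<^sub>C f = r *\<^sub>R f"
    by (transfer, auto intro!: blinfun_eqI simp: blinfun.add_left blinfun.add_right blinfun.scaleR_left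
        algebra_simps scaleR_conv_of_real)+
  have le: "norm (c *\<^sub>C f) \<le> norm c * norm f" for c and f :: "'a cdual"
    by transfer
       (rule norm_blinfun_bound, auto simp: norm_mult mult.assoc intro!: mult_left_mono norm_blinfun)
  show "norm (c *\<^sub>C f) = norm c * norm f"
  proof (cases "c = 0")
    case True
    then show ?thesis using le[of c f] by (simp add: norm_cdual.rep_eq)
  next
    case False
    have "inverse c *\<^sub>C c *\<^sub>C f = f"
      using False by transfer (auto intro!: blinfun_eqI)
    then have "norm f \<le> norm (inverse c) * norm (c *\<^sub>C f)"
      using le[of "inverse c" "c *\<^sub>C f"] by simp
    then have "norm c * norm f \<le> norm (c *\<^sub>C f)"
      using False by (simp add: norm_inverse norm_divide field_simps)
    then show ?thesis using le[of c f] by simp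
  qed
qed

end

lemma cdual_eqI: "(\<And>x. cdual_apply f x = cdual_apply g x) \<Longrightarrow> f = g"
  unfolding cdual_apply_def by transfer (rule blinfun_eqI)

lemma cdual_apply_add_right: "cdual_apply f (x + y) = cdual_apply f x + cdual_apply f y"
  and cdual_apply_scaleC_right: "cdual_apply f (c *\<^sub>C x) = c * cdual_apply f x"
  and cdual_apply_scaleR_right: "cdual_apply f (r *\<^sub>R x) = r *\<^sub>R cdual_apply f x"
  and cdual_apply_zero_left: "cdual_apply 0 x = 0"
  and cdual_apply_add_left: "cdual_apply (f + g) x = cdual_apply f x + cdual_apply g x"
  and cdual_apply_scaleC_left: "cdual_apply (c *\<^sub>C f) x = c * cdual_apply f x"
  and cdual_apply_scaleR_left: "cdual_apply (r *\<^sub>R f) x = r *\<^sub>R cdual_apply f x"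
  and cdual_apply_bound: "norm (cdual_apply f x) \<le> norm f * norm x"
  unfolding cdual_apply_def
  by (transfer, simp add: blinfun.add_left blinfun.add_right blinfun.scaleR_left blinfun.scaleR_right
      norm_blinfun)+

lemma norm_cdual_bound:
  "0 \<le> b \<Longrightarrow> (\<And>x. norm (cdual_apply f x) \<le> b * norm x) \<Longrightarrow> norm f \<le> b"
  unfolding cdual_apply_def by transfer (rule norm_blinfun_bound)

lemma blinfun_of_cdual_minus: "blinfun_of_cdual (f - g) = blinfun_of_cdual f - blinfun_of_cdual g"
  unfolding minus_cdual_def plus_cdual.rep_eq uminus_cdual.rep_eq by simp

lemma dist_cdual_eq: "dist f g = dist (blinfun_of_cdual f) (blinfun_of_cdual g)"
  by (simp add: dist_norm norm_cdual.rep_eq blinfun_of_cdual_minus)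

instance cdual :: (complex_normed_vector) banach
proof
  fix X :: "nat \<Rightarrow> 'a cdual"
  assume "Cauchy X"
  then have "Cauchy (\<lambda>n. blinfun_of_cdual (X n))"
    unfolding Cauchy_def dist_cdual_eq .
  then obtain l where l: "(\<lambda>n. blinfun_of_cdual (X n)) \<longlonglongrightarrow> l"
    using Cauchy_convergent convergent_def by blast
  have "blinfun_apply l (c *\<^sub>C x) = c * blinfun_apply l x" for c x
  proof (rule LIMSEQ_unique)
    show "(\<lambda>n. blinfun_apply (blinfun_of_cdual (X n)) (c *\<^sub>C x)) \<longlonglongrightarrow> blinfun_apply l (c *\<^sub>C x)"
      by (intro tendsto_intros l)
    have "(\<lambda>n. c * blinfun_apply (blinfun_of_cdual (X n)) x) \<longlonglongrightarrow> c * blinfun_apply l x"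
      by (intro tendsto_intros l)
    then show "(\<lambda>n. blinfun_apply (blinfun_of_cdual (X n)) (c *\<^sub>C x)) \<longlonglongrightarrow> c * blinfun_apply l x"
      using blinfun_of_cdual[of "X _"] by simp
  qed
  then have "blinfun_of_cdual (Cdual l) = l"
    by (simp add: Cdual_inverse)
  then have "X \<longlonglongrightarrow> Cdual l"
    using l unfolding lim_sequentially dist_cdual_eq by simp
  then show "convergent X" by (rule convergentI)
qed

text \<open>Meaningful for bounded complex-linear \<open>f\<close>; see \<open>cdual_apply_mk_cdual\<close>.\<close>

definition mk_cdual :: "('a::complex_normed_vector \<Rightarrow> complex) \<Rightarrow> 'a cdual" where
  "mk_cdual f = Cdual (Blinfun f)"

lemma cdual_apply_mk_cdual:
  assumes add: "\<And>x y. f (x + y) = f x + f y" and scale: "\<And>c x. f (c *\<^sub>C x) = c * f x"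
    and bound: "\<And>x. norm (f x) \<le> K * norm x"
  shows "cdual_apply (mk_cdual f) x = f x"
proof -
  have "bounded_linear f"
  proof (rule bounded_linear_intro[where K=K])
    show "f (r *\<^sub>R x) = r *\<^sub>R f x" for r x
      using scale[of "complex_of_real r" x] by (simp add: scaleC_of_real scaleR_conv_of_real)
  qed (auto simp: add bound mult.commute)
  then have "blinfun_apply (Blinfun f) = f" by (rule bounded_linear_Blinfun_apply)
  then show ?thesis
    unfolding cdual_apply_def mk_cdual_def by (subst Cdual_inverse) (auto simp: scale)
qed


section \<open>The second dual with the first Arens product\<close>

text \<open>
  For functionals \<open>f\<close> on the algebra, elements \<open>a, b\<close> of the algebra, and elements \<open>F, G\<close> of the
  second dual, the first Arens product \<open>F \<box> G\<close> is given in three steps: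
  \<open>\<langle>f \<cdot> a, b\<rangle> = \<langle>f, a b\<rangle>\<close>, \<open>\<langle>G \<cdot> f, a\<rangle> = \<langle>G, f \<cdot> a\<rangle>\<close>, \<open>\<langle>F \<box> G, f\<rangle> = \<langle>F, G \<cdot> f\<rangle>\<close>.
\<close>

definition dual_act :: "'a::complex_normed_algebra cdual \<Rightarrow> 'a \<Rightarrow> 'a cdual" where
  "dual_act f a = mk_cdual (\<lambda>b. cdual_apply f (a * b))"

definition bidual_act :: "'a::complex_normed_algebra cdual cdual \<Rightarrow> 'a cdual \<Rightarrow> 'a cdual" where
  "bidual_act G f = mk_cdual (\<lambda>a. cdual_apply G (dual_act f a))"

definition arens :: "'a::complex_normed_algebra cdual cdual \<Rightarrow> 'a cdual cdual \<Rightarrow> 'a cdual cdual" where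
  "arens F G = mk_cdual (\<lambda>f. cdual_apply F (bidual_act G f))"

lemma dual_act_apply: "cdual_apply (dual_act f a) b = cdual_apply f (a * b)"
  unfolding dual_act_def
proof (rule cdual_apply_mk_cdual)
  show "norm (cdual_apply f (a * x)) \<le> (norm f * norm a) * norm x" for x
    by (rule order_trans[OF cdual_apply_bound])
       (auto simp: mult.assoc intro!: mult_left_mono norm_mult_ineq)
qed (simp_all add: distrib_left cdual_apply_add_right mult_scaleC_right cdual_apply_scaleC_right)

lemma norm_dual_act: "norm (dual_act f a) \<le> norm f * norm a"
proof (rule norm_cdual_bound)
  show "norm (cdual_apply (dual_act f a) x) \<le> (norm f * norm a) * norm x" for x
    unfolding dual_act_apply
    by (rule order_trans[OF cdual_apply_bound])
       (auto simp: mult.assoc intro!: mult_left_mono norm_mult_ineq)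
qed simp

lemma dual_act_linear:
  "dual_act (f + g) a = dual_act f a + dual_act g a"
  "dual_act (c *\<^sub>C f) a = c *\<^sub>C dual_act f a"
  "dual_act f (a + b) = dual_act f a + dual_act f b"
  "dual_act f (c *\<^sub>C a) = c *\<^sub>C dual_act f a"
  "dual_act (dual_act f a) b = dual_act f (a * b)"
  by (auto intro!: cdual_eqI simp: dual_act_apply cdual_apply_add_left cdual_apply_scaleC_left
      cdual_apply_add_right cdual_apply_scaleC_right distrib_right mult_scaleC_left mult.assoc)

lemma bidual_act_apply: "cdual_apply (bidual_act G f) a = cdual_apply G (dual_act f a)"
  unfolding bidual_act_def
proof (rule cdual_apply_mk_cdual)
  show "norm (cdual_apply G (dual_act f x)) \<le> (norm G * norm f) * norm x" for x
    by (rule order_trans[OF cdual_apply_bound])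
       (auto simp: mult.assoc intro!: mult_left_mono norm_dual_act)
qed (simp_all add: dual_act_linear cdual_apply_add_right cdual_apply_scaleC_right)

lemma norm_bidual_act: "norm (bidual_act G f) \<le> norm G * norm f"
proof (rule norm_cdual_bound)
  show "norm (cdual_apply (bidual_act G f) x) \<le> (norm G * norm f) * norm x" for x
    unfolding bidual_act_apply
    by (rule order_trans[OF cdual_apply_bound])
       (auto simp: mult.assoc intro!: mult_left_mono norm_dual_act)
qed simp

lemma bidual_act_linear:
  "bidual_act (F + G) f = bidual_act F f + bidual_act G f"
  "bidual_act (c *\<^sub>C G) f = c *\<^sub>C bidual_act G f"
  "bidual_act G (f + g) = bidual_act G f + bidual_act G g"
  "bidual_act G (c *\<^sub>C f) = c *\<^sub>C bidual_act G f"
  "bidual_act G (dual_act f a) = dual_act (bidual_act G f) a"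
  by (auto intro!: cdual_eqI simp: bidual_act_apply dual_act_linear cdual_apply_add_left
      cdual_apply_scaleC_left cdual_apply_add_right cdual_apply_scaleC_right dual_act_apply)

lemma arens_apply: "cdual_apply (arens F G) f = cdual_apply F (bidual_act G f)"
  unfolding arens_def
proof (rule cdual_apply_mk_cdual)
  show "norm (cdual_apply F (bidual_act G x)) \<le> (norm F * norm G) * norm x" for x
    by (rule order_trans[OF cdual_apply_bound])
       (auto simp: mult.assoc intro!: mult_left_mono norm_bidual_act)
qed (simp_all add: bidual_act_linear cdual_apply_add_right cdual_apply_scaleC_right)

lemma bidual_act_arens: "bidual_act (arens F G) f = bidual_act F (bidual_act G f)"
  by (rule cdual_eqI) (simp add: bidual_act_apply arens_apply bidual_act_linear)

lemma norm_arens: "norm (arens F G) \<le> norm F * norm G"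
proof (rule norm_cdual_bound)
  show "norm (cdual_apply (arens F G) x) \<le> (norm F * norm G) * norm x" for x
    unfolding arens_apply
    by (rule order_trans[OF cdual_apply_bound])
       (auto simp: mult.assoc intro!: mult_left_mono norm_bidual_act)
qed simp

lemma arens_linear:
  "arens (F + G) H = arens F H + arens G H"
  "arens F (G + H) = arens F G + arens F H"
  "arens (c *\<^sub>C F) G = c *\<^sub>C arens F G"
  "arens F (c *\<^sub>C G) = c *\<^sub>C arens F G"
  "arens (arens F G) H = arens F (arens G H)"
  by (auto intro!: cdual_eqI simp: arens_apply bidual_act_linear bidual_act_arens cdual_apply_add_left
      cdual_apply_scaleC_left cdual_apply_add_right cdual_apply_scaleC_right)

text \<open>A copy of the second dual, needed as a type of its own so that it can carry the product.\<close>

typedef (overloaded) 'a bidual = "UNIV :: 'a::complex_normed_algebra cdual cdual set"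
  morphisms cdual_of_bidual Bidual
  by simp

instantiation bidual :: (complex_normed_algebra) complex_normed_algebra
begin

definition zero_bidual :: "'a bidual"
  where "zero_bidual = Bidual 0"

definition plus_bidual :: "'a bidual \<Rightarrow> 'a bidual \<Rightarrow> 'a bidual"
  where "plus_bidual F G = Bidual (cdual_of_bidual F + cdual_of_bidual G)"

definition minus_bidual :: "'a bidual \<Rightarrow> 'a bidual \<Rightarrow> 'a bidual"
  where "minus_bidual F G = Bidual (cdual_of_bidual F - cdual_of_bidual G)"

definition uminus_bidual :: "'a bidual \<Rightarrow> 'a bidual"
  where "uminus_bidual F = Bidual (- cdual_of_bidual F)"

definition scaleR_bidual :: "real \<Rightarrow> 'a bidual \<Rightarrow> 'a bidual"
  where "scaleR_bidual r F = Bidual (r *\<^sub>R cdual_of_bidual F)"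

definition scaleC_bidual :: "complex \<Rightarrow> 'a bidual \<Rightarrow> 'a bidual"
  where "scaleC_bidual c F = Bidual (c *\<^sub>C cdual_of_bidual F)"

definition times_bidual :: "'a bidual \<Rightarrow> 'a bidual \<Rightarrow> 'a bidual"
  where "times_bidual F G = Bidual (arens (cdual_of_bidual F) (cdual_of_bidual G))"

definition norm_bidual :: "'a bidual \<Rightarrow> real"
  where "norm_bidual F = norm (cdual_of_bidual F)"

definition dist_bidual :: "'a bidual \<Rightarrow> 'a bidual \<Rightarrow> real"
  where "dist_bidual F G = norm (F - G)"

definition sgn_bidual :: "'a bidual \<Rightarrow> 'a bidual"
  where "sgn_bidual F = scaleR (inverse (norm F)) F"

definition uniformity_bidual :: "('a bidual \<times> 'a bidual) filter"
  where "uniformity_bidual = (INF e\<in>{0 <..}. principal {(x, y). dist x y < e})"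

definition open_bidual :: "'a bidual set \<Rightarrow> bool"
  where "open_bidual S = (\<forall>x\<in>S. \<forall>\<^sub>F (x', y) in uniformity. x' = x \<longrightarrow> y \<in> S)"

lemma cdual_of_bidual_simps:
  "cdual_of_bidual 0 = 0"
  "cdual_of_bidual (F + G) = cdual_of_bidual F + cdual_of_bidual G"
  "cdual_of_bidual (F - G) = cdual_of_bidual F - cdual_of_bidual G"
  "cdual_of_bidual (- F) = - cdual_of_bidual F"
  "cdual_of_bidual (r *\<^sub>R F) = r *\<^sub>R cdual_of_bidual F"
  "cdual_of_bidual (c *\<^sub>C F) = c *\<^sub>C cdual_of_bidual F"
  "cdual_of_bidual (F * G) = arens (cdual_of_bidual F) (cdual_of_bidual G)"
  by (simp_all add: zero_bidual_def plus_bidual_def minus_bidual_def uminus_bidual_def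
      scaleR_bidual_def scaleC_bidual_def times_bidual_def Bidual_inverse)

instance
proof
  fix c d :: complex and r s :: real and f g h :: "'a bidual"
  note eq = cdual_of_bidual_inject[symmetric] cdual_of_bidual_simps
  show "f + g + h = f + (g + h)" "f + g = g + f" "0 + f = f" "- f + f = 0" "f - g = f + - g"
    "r *\<^sub>R (f + g) = r *\<^sub>R f + r *\<^sub>R g" "(r + s) *\<^sub>R f = r *\<^sub>R f + s *\<^sub>R f"
    "r *\<^sub>R s *\<^sub>R f = (r * s) *\<^sub>R f" "1 *\<^sub>R f = f"
    by (simp_all add: eq algebra_simps)
  show "(norm f = 0) = (f = 0)" "norm (f + g) \<le> norm f + norm g" "norm (r *\<^sub>R f) = \<bar>r\<bar> * norm f"
    by (simp_all add: norm_bidual_def eq norm_triangle_ineq)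
  show "dist f g = norm (f - g)" "sgn f = scaleR (inverse (norm f)) f"
    by (simp_all add: dist_bidual_def sgn_bidual_def)
  show "(uniformity :: ('a bidual \<times> 'a bidual) filter) = (INF e\<in>{0 <..}. principal {(x, y). dist x y < e})"
    by (rule uniformity_bidual_def)
  show "open U = (\<forall>x\<in>U. \<forall>\<^sub>F (x', y) in uniformity. x' = x \<longrightarrow> y \<in> U)" for U :: "'a bidual set"
    by (rule open_bidual_def)
  show "c *\<^sub>C (f + g) = c *\<^sub>C f + c *\<^sub>C g" "(c + d) *\<^sub>C f = c *\<^sub>C f + d *\<^sub>C f"
    "c *\<^sub>C d *\<^sub>C f = (c * d) *\<^sub>C f" "complex_of_real r *\<^sub>C f = r *\<^sub>R f"
    by (simp_all add: eq scaleC_add_right scaleC_add_left scaleC_scaleC scaleC_of_real)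
  show "norm (c *\<^sub>C f) = norm c * norm f"
    by (simp add: norm_bidual_def eq norm_scaleC)
  show "f * g * h = f * (g * h)" "(f + g) * h = f * h + g * h" "f * (g + h) = f * g + f * h"
    "(c *\<^sub>C f) * g = c *\<^sub>C (f * g)" "f * (c *\<^sub>C g) = c *\<^sub>C (f * g)"
    by (simp_all add: eq arens_linear)
  show "r *\<^sub>R f * g = r *\<^sub>R (f * g)" "f * r *\<^sub>R g = r *\<^sub>R (f * g)"
    by (simp_all add: eq arens_linear flip: scaleC_of_real)
  show "norm (f * g) \<le> norm f * norm g"
    by (simp add: norm_bidual_def eq norm_arens)
qed

end

lemma dist_bidual_eq: "dist F G = dist (cdual_of_bidual F) (cdual_of_bidual G)"
  unfolding dist_norm dist_bidual_def norm_bidual_def cdual_of_bidual_simps ..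

instance bidual :: (complex_normed_algebra) banach
proof
  fix X :: "nat \<Rightarrow> 'a bidual"
  assume "Cauchy X"
  then have "Cauchy (\<lambda>n. cdual_of_bidual (X n))"
    unfolding Cauchy_def dist_bidual_eq .
  then obtain l where l: "(\<lambda>n. cdual_of_bidual (X n)) \<longlonglongrightarrow> l"
    using Cauchy_convergent convergent_def by blast
  have "dist (X n) (Bidual l) = dist (cdual_of_bidual (X n)) l" for n
    by (simp add: dist_bidual_eq Bidual_inverse)
  moreover have "\<forall>e>0. \<exists>N. \<forall>n\<ge>N. dist (cdual_of_bidual (X n)) l < e"
    using l unfolding lim_sequentially .
  ultimately have "\<forall>e>0. \<exists>N. \<forall>n\<ge>N. dist (X n) (Bidual l) < e"
    by simp
  then show "convergent X"
    unfolding convergent_def lim_sequentially by blast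
qed

instance bidual :: (complex_normed_algebra) complex_banach_algebra ..


section \<open>Banach bimodules, derivations and contractibility\<close>

text \<open>
  Bimodules have explicit carriers, so that one can quantify over all of them.  Elements outside
  the carrier and values of the operations there are unconstrained.  No unit of the algebra is
  assumed, hence bimodules are not required to be unital.
\<close>

record ('b, 'e) bimodule =
  bm_carrier :: "'e set"
  bm_zero :: 'e  ("\<zero>\<index>")
  bm_add :: "'e \<Rightarrow> 'e \<Rightarrow> 'e"  (infixl "\<oplus>\<index>" 65)
  bm_scale :: "complex \<Rightarrow> 'e \<Rightarrow> 'e"  (infixr "\<odot>\<index>" 75)
  bm_norm :: "'e \<Rightarrow> real"  ("\<nu>\<index>")
  bm_left :: "'b \<Rightarrow> 'e \<Rightarrow> 'e"  (infixr "\<rhd>\<index>" 70)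
  bm_right :: "'e \<Rightarrow> 'b \<Rightarrow> 'e"  (infixl "\<lhd>\<index>" 70)

definition bm_diff :: "('b, 'e, 'm) bimodule_scheme \<Rightarrow> 'e \<Rightarrow> 'e \<Rightarrow> 'e"  (infixl "\<ominus>\<index>" 65) where
  "bm_diff E x y = x \<oplus>\<^bsub>E\<^esub> (-1) \<odot>\<^bsub>E\<^esub> y"

locale banach_bimodule =
  fixes E :: "('b::complex_banach_algebra, 'e) bimodule" (structure)
  assumes zero_closed: "\<zero> \<in> bm_carrier E"
    and add_closed: "\<lbrakk>x \<in> bm_carrier E; y \<in> bm_carrier E\<rbrakk> \<Longrightarrow> x \<oplus> y \<in> bm_carrier E"
    and scale_closed: "x \<in> bm_carrier E \<Longrightarrow> c \<odot> x \<in> bm_carrier E"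
    and left_closed: "x \<in> bm_carrier E \<Longrightarrow> a \<rhd> x \<in> bm_carrier E"
    and right_closed: "x \<in> bm_carrier E \<Longrightarrow> x \<lhd> a \<in> bm_carrier E"
    and add_assoc: "\<lbrakk>x \<in> bm_carrier E; y \<in> bm_carrier E; z \<in> bm_carrier E\<rbrakk> \<Longrightarrow>
      (x \<oplus> y) \<oplus> z = x \<oplus> (y \<oplus> z)"
    and add_commute: "\<lbrakk>x \<in> bm_carrier E; y \<in> bm_carrier E\<rbrakk> \<Longrightarrow> x \<oplus> y = y \<oplus> x"
    and add_zero: "x \<in> bm_carrier E \<Longrightarrow> x \<oplus> \<zero> = x"
    and add_inverse: "x \<in> bm_carrier E \<Longrightarrow> \<exists>y\<in>bm_carrier E. x \<oplus> y = \<zero>"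
    and scale_add_right: "\<lbrakk>x \<in> bm_carrier E; y \<in> bm_carrier E\<rbrakk> \<Longrightarrow> c \<odot> (x \<oplus> y) = c \<odot> x \<oplus> c \<odot> y"
    and scale_add_left: "x \<in> bm_carrier E \<Longrightarrow> (c + d) \<odot> x = c \<odot> x \<oplus> d \<odot> x"
    and scale_scale: "x \<in> bm_carrier E \<Longrightarrow> c \<odot> d \<odot> x = (c * d) \<odot> x"
    and scale_one: "x \<in> bm_carrier E \<Longrightarrow> 1 \<odot> x = x"
    and norm_eq_zero: "x \<in> bm_carrier E \<Longrightarrow> \<nu> x = 0 \<longleftrightarrow> x = \<zero>"
    and norm_triangle: "\<lbrakk>x \<in> bm_carrier E; y \<in> bm_carrier E\<rbrakk> \<Longrightarrow> \<nu> (x \<oplus> y) \<le> \<nu> x + \<nu> y"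
    and norm_scale: "x \<in> bm_carrier E \<Longrightarrow> \<nu> (c \<odot> x) = norm c * \<nu> x"
    and complete: "\<lbrakk>range (s :: nat \<Rightarrow> 'e) \<subseteq> bm_carrier E; \<forall>e>0. \<exists>N. \<forall>m\<ge>N. \<forall>n\<ge>N. \<nu> (s m \<ominus> s n) < e\<rbrakk> \<Longrightarrow>
      \<exists>l\<in>bm_carrier E. \<forall>e>0. \<exists>N. \<forall>n\<ge>N. \<nu> (s n \<ominus> l) < e"
    and left_add: "x \<in> bm_carrier E \<Longrightarrow> (a + b) \<rhd> x = (a \<rhd> x) \<oplus> (b \<rhd> x)"
    and left_add': "\<lbrakk>x \<in> bm_carrier E; y \<in> bm_carrier E\<rbrakk> \<Longrightarrow> a \<rhd> (x \<oplus> y) = (a \<rhd> x) \<oplus> (a \<rhd> y)"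
    and left_scale: "x \<in> bm_carrier E \<Longrightarrow> (c *\<^sub>C a) \<rhd> x = c \<odot> (a \<rhd> x)"
    and left_scale': "x \<in> bm_carrier E \<Longrightarrow> a \<rhd> (c \<odot> x) = c \<odot> (a \<rhd> x)"
    and left_mult: "x \<in> bm_carrier E \<Longrightarrow> (a * b) \<rhd> x = a \<rhd> (b \<rhd> x)"
    and right_add: "x \<in> bm_carrier E \<Longrightarrow> x \<lhd> (a + b) = (x \<lhd> a) \<oplus> (x \<lhd> b)"
    and right_add': "\<lbrakk>x \<in> bm_carrier E; y \<in> bm_carrier E\<rbrakk> \<Longrightarrow> (x \<oplus> y) \<lhd> a = (x \<lhd> a) \<oplus> (y \<lhd> a)"
    and right_scale: "x \<in> bm_carrier E \<Longrightarrow> x \<lhd> (c *\<^sub>C a) = c \<odot> (x \<lhd> a)"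
    and right_scale': "x \<in> bm_carrier E \<Longrightarrow> (c \<odot> x) \<lhd> a = c \<odot> (x \<lhd> a)"
    and right_mult: "x \<in> bm_carrier E \<Longrightarrow> x \<lhd> (a * b) = (x \<lhd> a) \<lhd> b"
    and left_right: "x \<in> bm_carrier E \<Longrightarrow> a \<rhd> (x \<lhd> b) = (a \<rhd> x) \<lhd> b"
    and left_bounded: "\<exists>K. \<forall>a. \<forall>x\<in>bm_carrier E. \<nu> (a \<rhd> x) \<le> K * norm a * \<nu> x"
    and right_bounded: "\<exists>K. \<forall>a. \<forall>x\<in>bm_carrier E. \<nu> (x \<lhd> a) \<le> K * norm a * \<nu> x"

definition derivation :: "('b::complex_banach_algebra, 'e) bimodule \<Rightarrow> ('b \<Rightarrow> 'e) \<Rightarrow> bool" where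
  "derivation E D \<longleftrightarrow>
     (\<forall>a. D a \<in> bm_carrier E) \<and>
     (\<forall>a b. D (a + b) = D a \<oplus>\<^bsub>E\<^esub> D b) \<and>
     (\<forall>c a. D (c *\<^sub>C a) = c \<odot>\<^bsub>E\<^esub> D a) \<and>
     (\<exists>K. \<forall>a. \<nu>\<^bsub>E\<^esub> (D a) \<le> K * norm a) \<and>
     (\<forall>a b. D (a * b) = (D a \<lhd>\<^bsub>E\<^esub> b) \<oplus>\<^bsub>E\<^esub> (a \<rhd>\<^bsub>E\<^esub> D b))"

definition inner_derivation :: "('b::complex_banach_algebra, 'e) bimodule \<Rightarrow> ('b \<Rightarrow> 'e) \<Rightarrow> bool" where
  "inner_derivation E D \<longleftrightarrow> (\<exists>z\<in>bm_carrier E. \<forall>a. D a = (z \<lhd>\<^bsub>E\<^esub> a) \<ominus>\<^bsub>E\<^esub> (a \<rhd>\<^bsub>E\<^esub> z))"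

text \<open>
  A formula cannot quantify over types, so contractibility quantifies over the bimodules whose
  carrier is contained in one fixed type, chosen large enough to contain an isomorphic copy of the
  closed sub-bimodule generated by the range of any derivation.  The theorem
  \<open>contractible_algebra_inner\<close> below shows that this is no restriction: in a contractible algebra,
  derivations into Banach bimodules over arbitrary types are inner.
\<close>

type_synonym 'b bimodule_universe = "nat \<Rightarrow> ('b \<times> 'b \<times> 'b) list"

definition contractible_algebra :: "'b::complex_banach_algebra itself \<Rightarrow> bool" where
  "contractible_algebra (_ :: 'b itself) \<longleftrightarrow>
     (\<forall>(E :: ('b, 'b bimodule_universe) bimodule) D.
        banach_bimodule E \<longrightarrow> derivation E D \<longrightarrow> inner_derivation E D)"

context banach_bimodule
begin

lemma scale_zero_left: "x \<in> bm_carrier E \<Longrightarrow> 0 \<odot> x = \<zero>"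
proof -
  assume x: "x \<in> bm_carrier E"
  let ?z = "0 \<odot> x"
  have z: "?z \<in> bm_carrier E" "?z \<oplus> ?z = ?z"
    using scale_closed[OF x] scale_add_left[OF x, of 0 0] by auto
  obtain y where y: "y \<in> bm_carrier E" "?z \<oplus> y = \<zero>" using add_inverse[OF z(1)] by blast
  have "?z \<oplus> (?z \<oplus> y) = ?z \<oplus> y" using add_assoc[OF z(1) z(1) y(1)] z(2) by simp
  then show ?thesis using y add_zero[OF z(1)] by simp
qed

lemma scale_zero_right: "c \<odot> \<zero> = \<zero>"
  by (metis scale_zero_left zero_closed scale_scale mult_zero_right)

lemma diff_closed: "\<lbrakk>x \<in> bm_carrier E; y \<in> bm_carrier E\<rbrakk> \<Longrightarrow> x \<ominus> y \<in> bm_carrier E"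
  by (simp add: bm_diff_def add_closed scale_closed)

lemma diff_self: "x \<in> bm_carrier E \<Longrightarrow> x \<ominus> x = \<zero>"
  unfolding bm_diff_def
  by (metis scale_add_left scale_one scale_zero_left add.right_inverse)

lemma add_left_commute:
  "\<lbrakk>x \<in> bm_carrier E; y \<in> bm_carrier E; z \<in> bm_carrier E\<rbrakk> \<Longrightarrow> x \<oplus> (y \<oplus> z) = y \<oplus> (x \<oplus> z)"
  by (metis add_assoc add_commute)

lemma zero_add: "x \<in> bm_carrier E \<Longrightarrow> \<zero> \<oplus> x = x"
  by (metis add_commute add_zero zero_closed)

lemma norm_zero: "\<nu> \<zero> = 0"
  by (simp add: norm_eq_zero zero_closed)

lemma diff_add_diff:
  assumes "x \<in> bm_carrier E" "y \<in> bm_carrier E" "z \<in> bm_carrier E"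
  shows "(x \<ominus> y) \<oplus> (y \<ominus> z) = x \<ominus> z"
proof -
  let ?y = "(-1) \<odot> y" and ?z = "(-1) \<odot> z"
  have c: "?y \<in> bm_carrier E" "?z \<in> bm_carrier E" using assms scale_closed by auto
  have "?y \<oplus> (y \<oplus> ?z) = (y \<oplus> ?y) \<oplus> ?z"
    using assms c by (metis add_assoc add_left_commute)
  also have "\<dots> = ?z" using diff_self[OF assms(2)] c zero_add by (simp add: bm_diff_def)
  finally show ?thesis using assms c
    by (simp add: bm_diff_def add_assoc add_closed)
qed

lemma diff_add_cancel: "\<lbrakk>x \<in> bm_carrier E; y \<in> bm_carrier E\<rbrakk> \<Longrightarrow> (x \<ominus> y) \<oplus> y = x"
  using diff_self[of y] unfolding bm_diff_def
  by (metis add_assoc add_commute add_zero scale_closed)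

lemma minus_diff:
  assumes "x \<in> bm_carrier E" "y \<in> bm_carrier E"
  shows "(-1) \<odot> (x \<ominus> y) = y \<ominus> x"
  using assms by (simp add: bm_diff_def scale_add_right scale_closed scale_scale scale_one add_commute)

lemma diff_eq_zero: "\<lbrakk>x \<in> bm_carrier E; y \<in> bm_carrier E; x \<ominus> y = \<zero>\<rbrakk> \<Longrightarrow> x = y"
  by (metis diff_add_cancel zero_add)

lemma add_diff_add:
  assumes "x \<in> bm_carrier E" "y \<in> bm_carrier E" "x' \<in> bm_carrier E" "y' \<in> bm_carrier E"
  shows "(x \<oplus> y) \<ominus> (x' \<oplus> y') = (x \<ominus> x') \<oplus> (y \<ominus> y')"
  using assms by (simp add: bm_diff_def scale_add_right scale_closed add_closed add_assoc add_left_commute)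

lemma scale_diff: "\<lbrakk>x \<in> bm_carrier E; y \<in> bm_carrier E\<rbrakk> \<Longrightarrow> c \<odot> (x \<ominus> y) = c \<odot> x \<ominus> c \<odot> y"
  by (simp add: bm_diff_def scale_add_right scale_closed scale_scale mult.commute)

lemma left_diff: "\<lbrakk>x \<in> bm_carrier E; y \<in> bm_carrier E\<rbrakk> \<Longrightarrow> a \<rhd> (x \<ominus> y) = (a \<rhd> x) \<ominus> (a \<rhd> y)"
  by (simp add: bm_diff_def left_add' left_scale' scale_closed)

lemma right_diff: "\<lbrakk>x \<in> bm_carrier E; y \<in> bm_carrier E\<rbrakk> \<Longrightarrow> (x \<ominus> y) \<lhd> a = (x \<lhd> a) \<ominus> (y \<lhd> a)"
  by (simp add: bm_diff_def right_add' right_scale' scale_closed)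

lemma norm_nonneg: "x \<in> bm_carrier E \<Longrightarrow> 0 \<le> \<nu> x"
  using norm_triangle[of x "(-1) \<odot> x"] diff_self[of x] norm_scale[of x "-1"]
  by (simp add: bm_diff_def scale_closed norm_zero)

lemma norm_diff_commute: "\<lbrakk>x \<in> bm_carrier E; y \<in> bm_carrier E\<rbrakk> \<Longrightarrow> \<nu> (x \<ominus> y) = \<nu> (y \<ominus> x)"
  using norm_scale[OF diff_closed, of x y "-1"] by (simp add: minus_diff)

lemma norm_diff_triangle:
  "\<lbrakk>x \<in> bm_carrier E; y \<in> bm_carrier E; z \<in> bm_carrier E\<rbrakk> \<Longrightarrow> \<nu> (x \<ominus> z) \<le> \<nu> (x \<ominus> y) + \<nu> (y \<ominus> z)"
  using norm_triangle[OF diff_closed diff_closed, of x y y z] by (simp add: diff_add_diff)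

text \<open>Norm closure of a set of elements.\<close>

definition bm_closure :: "'e set \<Rightarrow> 'e set" where
  "bm_closure P = {x \<in> bm_carrier E. \<forall>e>0. \<exists>p\<in>P. \<nu> (p \<ominus> x) < e}"

lemma subset_bm_closure: "P \<subseteq> bm_carrier E \<Longrightarrow> P \<subseteq> bm_closure P"
  unfolding bm_closure_def by (auto intro!: bexI simp: diff_self norm_zero)

lemma bm_closure_add:
  assumes P: "P \<subseteq> bm_carrier E" "\<And>p q. \<lbrakk>p \<in> P; q \<in> P\<rbrakk> \<Longrightarrow> p \<oplus> q \<in> P"
    and x: "x \<in> bm_closure P" and y: "y \<in> bm_closure P"
  shows "x \<oplus> y \<in> bm_closure P"
  unfolding bm_closure_def
proof (intro CollectI conjI allI impI)
  have c: "x \<in> bm_carrier E" "y \<in> bm_carrier E" using x y by (auto simp: bm_closure_def)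
  show "x \<oplus> y \<in> bm_carrier E" using c by (rule add_closed)
  fix e :: real assume "e > 0"
  then have "e / 2 > 0" by simp
  then obtain p q where pq: "p \<in> P" "\<nu> (p \<ominus> x) < e / 2" "q \<in> P" "\<nu> (q \<ominus> y) < e / 2"
    using x y unfolding bm_closure_def by blast
  have pqc: "p \<in> bm_carrier E" "q \<in> bm_carrier E" using pq P(1) by auto
  have "\<nu> ((p \<oplus> q) \<ominus> (x \<oplus> y)) \<le> \<nu> (p \<ominus> x) + \<nu> (q \<ominus> y)"
    using norm_triangle[OF diff_closed diff_closed, of p x q y] pqc c by (simp add: add_diff_add)
  then have "\<nu> ((p \<oplus> q) \<ominus> (x \<oplus> y)) < e" using pq by linarith
  then show "\<exists>r\<in>P. \<nu> (r \<ominus> (x \<oplus> y)) < e" using P(2) pq by blast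
qed

lemma bm_closure_op:
  assumes P: "P \<subseteq> bm_carrier E" "\<And>p. p \<in> P \<Longrightarrow> T p \<in> P"
    and Tc: "\<And>x. x \<in> bm_carrier E \<Longrightarrow> T x \<in> bm_carrier E"
    and Td: "\<And>x y. \<lbrakk>x \<in> bm_carrier E; y \<in> bm_carrier E\<rbrakk> \<Longrightarrow> T (x \<ominus> y) = T x \<ominus> T y"
    and Tb: "\<And>x. x \<in> bm_carrier E \<Longrightarrow> \<nu> (T x) \<le> K * \<nu> x"
    and x: "x \<in> bm_closure P"
  shows "T x \<in> bm_closure P"
  unfolding bm_closure_def
proof (intro CollectI conjI allI impI)
  have c: "x \<in> bm_carrier E" using x by (auto simp: bm_closure_def)
  show "T x \<in> bm_carrier E" using c by (rule Tc)
  fix e :: real assume "e > 0"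
  then have "e / (\<bar>K\<bar> + 1) > 0" by (simp add: add_nonneg_pos)
  then obtain p where p: "p \<in> P" "\<nu> (p \<ominus> x) < e / (\<bar>K\<bar> + 1)"
    using x unfolding bm_closure_def by blast
  have pc: "p \<in> bm_carrier E" using p P(1) by auto
  have "\<nu> (T p \<ominus> T x) \<le> K * \<nu> (p \<ominus> x)"
    using Tb[OF diff_closed[OF pc c]] by (simp add: Td pc c)
  also have "\<dots> \<le> (\<bar>K\<bar> + 1) * \<nu> (p \<ominus> x)"
    by (rule mult_right_mono) (auto intro: norm_nonneg diff_closed pc c)
  also have "\<dots> < e" using p(2) by (simp add: field_simps add_nonneg_pos)
  finally show "\<exists>r\<in>P. \<nu> (r \<ominus> T x) < e" using P(2) p by blast
qed

lemma bm_closure_limit: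
  assumes P: "P \<subseteq> bm_carrier E" and l: "l \<in> bm_carrier E"
    and s: "\<And>e. e > 0 \<Longrightarrow> \<exists>x\<in>bm_closure P. \<nu> (x \<ominus> l) < e"
  shows "l \<in> bm_closure P"
  unfolding bm_closure_def
proof (intro CollectI conjI allI impI l)
  fix e :: real assume "e > 0"
  then have e: "e / 2 > 0" by simp
  obtain x where x: "x \<in> bm_closure P" "\<nu> (x \<ominus> l) < e / 2" using s[OF e] by blast
  then obtain p where p: "p \<in> P" "\<nu> (p \<ominus> x) < e / 2" using e unfolding bm_closure_def by blast
  have "\<nu> (p \<ominus> l) \<le> \<nu> (p \<ominus> x) + \<nu> (x \<ominus> l)"
    using x p P l by (intro norm_diff_triangle) (auto simp: bm_closure_def)
  then show "\<exists>r\<in>P. \<nu> (r \<ominus> l) < e" using x p by force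
qed

text \<open>A copy, inside another type, of a closed sub-bimodule \<open>S\<close> along an injection \<open>h\<close>.\<close>

definition bm_copy :: "'e set \<Rightarrow> ('e \<Rightarrow> 'u) \<Rightarrow> ('b, 'u) bimodule" where
  "bm_copy S h = (let g = inv_into S h in
    \<lparr>bm_carrier = h ` S, bm_zero = h \<zero>, bm_add = \<lambda>u v. h (g u \<oplus> g v), bm_scale = \<lambda>c u. h (c \<odot> g u),
     bm_norm = \<lambda>u. \<nu> (g u), bm_left = \<lambda>a u. h (a \<rhd> g u), bm_right = \<lambda>u a. h (g u \<lhd> a)\<rparr>)"

lemma bm_copy:
  fixes h :: "'e \<Rightarrow> 'u"
  assumes inj: "inj_on h S" and S: "S \<subseteq> bm_carrier E"
    and S0: "\<zero> \<in> S" and S_add: "\<And>x y. \<lbrakk>x \<in> S; y \<in> S\<rbrakk> \<Longrightarrow> x \<oplus> y \<in> S"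
    and S_scale: "\<And>c x. x \<in> S \<Longrightarrow> c \<odot> x \<in> S"
    and S_left: "\<And>a x. x \<in> S \<Longrightarrow> a \<rhd> x \<in> S" and S_right: "\<And>a x. x \<in> S \<Longrightarrow> x \<lhd> a \<in> S"
    and S_lim: "\<And>l. \<lbrakk>l \<in> bm_carrier E; \<And>e. e > 0 \<Longrightarrow> \<exists>x\<in>S. \<nu> (x \<ominus> l) < e\<rbrakk> \<Longrightarrow> l \<in> S"
  shows bm_copy_simps:
      "bm_carrier (bm_copy S h) = h ` S"
      "\<zero>\<^bsub>bm_copy S h\<^esub> = h \<zero>"
      "\<And>x y. \<lbrakk>x \<in> S; y \<in> S\<rbrakk> \<Longrightarrow> h x \<oplus>\<^bsub>bm_copy S h\<^esub> h y = h (x \<oplus> y)"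
      "\<And>x y. \<lbrakk>x \<in> S; y \<in> S\<rbrakk> \<Longrightarrow> h x \<ominus>\<^bsub>bm_copy S h\<^esub> h y = h (x \<ominus> y)"
      "\<And>c x. x \<in> S \<Longrightarrow> c \<odot>\<^bsub>bm_copy S h\<^esub> h x = h (c \<odot> x)"
      "\<And>x. x \<in> S \<Longrightarrow> \<nu>\<^bsub>bm_copy S h\<^esub> (h x) = \<nu> x"
      "\<And>a x. x \<in> S \<Longrightarrow> a \<rhd>\<^bsub>bm_copy S h\<^esub> h x = h (a \<rhd> x)"
      "\<And>a x. x \<in> S \<Longrightarrow> h x \<lhd>\<^bsub>bm_copy S h\<^esub> a = h (x \<lhd> a)"
    and banach_bimodule_bm_copy: "banach_bimodule (bm_copy S h)"
proof -
  have g: "inv_into S h (h x) = x" if "x \<in> S" for x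
    using inj that by simp
  show sim: "bm_carrier (bm_copy S h) = h ` S"
      "\<zero>\<^bsub>bm_copy S h\<^esub> = h \<zero>"
      "\<And>x y. \<lbrakk>x \<in> S; y \<in> S\<rbrakk> \<Longrightarrow> h x \<oplus>\<^bsub>bm_copy S h\<^esub> h y = h (x \<oplus> y)"
      "\<And>x y. \<lbrakk>x \<in> S; y \<in> S\<rbrakk> \<Longrightarrow> h x \<ominus>\<^bsub>bm_copy S h\<^esub> h y = h (x \<ominus> y)"
      "\<And>c x. x \<in> S \<Longrightarrow> c \<odot>\<^bsub>bm_copy S h\<^esub> h x = h (c \<odot> x)"
      "\<And>x. x \<in> S \<Longrightarrow> \<nu>\<^bsub>bm_copy S h\<^esub> (h x) = \<nu> x"
      "\<And>a x. x \<in> S \<Longrightarrow> a \<rhd>\<^bsub>bm_copy S h\<^esub> h x = h (a \<rhd> x)"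
      "\<And>a x. x \<in> S \<Longrightarrow> h x \<lhd>\<^bsub>bm_copy S h\<^esub> a = h (x \<lhd> a)"
    by (simp_all add: bm_copy_def Let_def g bm_diff_def S_scale)
  have Sc: "x \<in> S \<Longrightarrow> x \<in> bm_carrier E" for x using S by blast
  have S_diff: "\<lbrakk>x \<in> S; y \<in> S\<rbrakk> \<Longrightarrow> x \<ominus> y \<in> S" for x y
    by (simp add: bm_diff_def S_add S_scale)
  note clo = S0 S_add S_scale S_left S_right
  note sim' = sim(1-3,5-8)
  show "banach_bimodule (bm_copy S h)"
  proof (unfold_locales, unfold sim(1))
    fix s :: "nat \<Rightarrow> 'u"
    assume s: "range s \<subseteq> h ` S"
      and cau: "\<forall>e>0. \<exists>N. \<forall>m\<ge>N. \<forall>n\<ge>N. \<nu>\<^bsub>bm_copy S h\<^esub> (s m \<ominus>\<^bsub>bm_copy S h\<^esub> s n) < e"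
    define t where "t n = inv_into S h (s n)" for n
    have t: "t n \<in> S" "h (t n) = s n" for n
      using subsetD[OF s rangeI[of s n]] unfolding t_def by (rule inv_into_into, rule f_inv_into_f)
    have "\<nu>\<^bsub>bm_copy S h\<^esub> (s m \<ominus>\<^bsub>bm_copy S h\<^esub> s n) = \<nu> (t m \<ominus> t n)" for m n
      using t by (simp add: sim S_diff flip: t(2))
    then have "\<forall>e>0. \<exists>N. \<forall>m\<ge>N. \<forall>n\<ge>N. \<nu> (t m \<ominus> t n) < e"
      using cau by simp
    moreover have "range t \<subseteq> bm_carrier E"
      using t(1) S by blast
    ultimately obtain l where l: "l \<in> bm_carrier E" "\<forall>e>0. \<exists>N. \<forall>n\<ge>N. \<nu> (t n \<ominus> l) < e"
      using complete[of t] by blast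
    have lS: "l \<in> S"
      using l t(1) by (intro S_lim) blast+
    have "\<nu>\<^bsub>bm_copy S h\<^esub> (s n \<ominus>\<^bsub>bm_copy S h\<^esub> h l) = \<nu> (t n \<ominus> l)" for n
      using t lS by (simp add: sim S_diff flip: t(2))
    then show "\<exists>l\<in>h ` S. \<forall>e>0. \<exists>N. \<forall>n\<ge>N. \<nu>\<^bsub>bm_copy S h\<^esub> (s n \<ominus>\<^bsub>bm_copy S h\<^esub> l) < e"
      using l(2) lS by (intro bexI[of _ "h l"]) auto
  next
    fix x assume "x \<in> h ` S"
    then obtain x' where x': "x = h x'" "x' \<in> S" by blast
    have "(-1) \<odot> x' \<in> S" "x' \<oplus> (-1) \<odot> x' = \<zero>"
      using x' diff_self[of x'] by (auto simp: bm_diff_def S_scale Sc)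
    then show "\<exists>y\<in>h ` S. x \<oplus>\<^bsub>bm_copy S h\<^esub> y = \<zero>\<^bsub>bm_copy S h\<^esub>"
      using x' by (intro bexI[of _ "h ((-1) \<odot> x')"]) (auto simp: sim')
    show "(\<nu>\<^bsub>bm_copy S h\<^esub> x = 0) = (x = \<zero>\<^bsub>bm_copy S h\<^esub>)"
      using x' inj_on_eq_iff[OF inj x'(2) S0] by (simp add: sim' norm_eq_zero Sc)
  next
    obtain K where "\<forall>a. \<forall>x\<in>bm_carrier E. \<nu> (a \<rhd> x) \<le> K * norm a * \<nu> x" using left_bounded by blast
    then show "\<exists>K. \<forall>a. \<forall>x\<in>h ` S. \<nu>\<^bsub>bm_copy S h\<^esub> (a \<rhd>\<^bsub>bm_copy S h\<^esub> x) \<le> K * norm a * \<nu>\<^bsub>bm_copy S h\<^esub> x"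
      by (intro exI[of _ K]) (auto simp: sim' clo Sc)
  next
    obtain K where "\<forall>a. \<forall>x\<in>bm_carrier E. \<nu> (x \<lhd> a) \<le> K * norm a * \<nu> x" using right_bounded by blast
    then show "\<exists>K. \<forall>a. \<forall>x\<in>h ` S. \<nu>\<^bsub>bm_copy S h\<^esub> (x \<lhd>\<^bsub>bm_copy S h\<^esub> a) \<le> K * norm a * \<nu>\<^bsub>bm_copy S h\<^esub> x"
      by (intro exI[of _ K]) (auto simp: sim' clo Sc)
  next
    fix x y assume "x \<in> h ` S" "y \<in> h ` S"
    then show "x \<oplus>\<^bsub>bm_copy S h\<^esub> y = y \<oplus>\<^bsub>bm_copy S h\<^esub> x"
      by (auto simp: sim' add_commute Sc)
  qed (auto simp: sim' clo Sc add_assoc add_zero scale_add_right scale_add_left scale_scale scale_one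
      norm_triangle norm_scale left_add left_add' left_scale left_scale' left_mult
      right_add right_add' right_scale right_scale' right_mult left_right)
qed

end

text \<open>
  Sums of elements \<open>D a\<close> and \<open>D b c\<close>, coded by lists of triples; they form the sub-bimodule
  generated by the range of the derivation \<open>D\<close>.
\<close>

primrec derivation_sum :: "('b::complex_banach_algebra, 'e) bimodule \<Rightarrow> ('b \<Rightarrow> 'e) \<Rightarrow> ('b \<times> 'b \<times> 'b) list \<Rightarrow> 'e" where
  "derivation_sum E D [] = \<zero>\<^bsub>E\<^esub>"
| "derivation_sum E D (t # ts) =
     (D (fst t) \<oplus>\<^bsub>E\<^esub> (D (fst (snd t)) \<lhd>\<^bsub>E\<^esub> snd (snd t))) \<oplus>\<^bsub>E\<^esub> derivation_sum E D ts"

locale banach_derivation = banach_bimodule E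
  for E :: "('b::complex_banach_algebra, 'e) bimodule" (structure) +
  fixes D :: "'b \<Rightarrow> 'e"
  assumes der: "derivation E D"
begin

lemma D_closed: "D a \<in> bm_carrier E"
  and D_add: "D (a + b) = D a \<oplus> D b"
  and D_scale: "D (c *\<^sub>C a) = c \<odot> D a"
  and D_mult: "D (a * b) = (D a \<lhd> b) \<oplus> (a \<rhd> D b)"
  using der by (auto simp: derivation_def)

lemma D_zero: "D 0 = \<zero>"
  using D_scale[of 0 0] scale_zero_left[OF D_closed] by (simp add: scaleC_zero_right)

lemma right_zero: "x \<in> bm_carrier E \<Longrightarrow> x \<lhd> 0 = \<zero>"
  using right_scale[of x 0 0] scale_zero_left[OF right_closed] by (simp add: scaleC_zero_right)

lemma zero_right: "\<zero> \<lhd> a = \<zero>"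
  using right_scale'[OF zero_closed, of 0 a] scale_zero_left[OF right_closed[OF zero_closed]]
  by (simp add: scale_zero_right)

lemma zero_left: "a \<rhd> \<zero> = \<zero>"
  using left_scale'[OF zero_closed, of a 0] scale_zero_left[OF left_closed[OF zero_closed]]
  by (simp add: scale_zero_right)

lemma D_minus: "D (- a) = (-1) \<odot> D a"
  using D_scale[of "-1" a] by (simp add: scaleC_minus_one)

lemma left_D: "a \<rhd> D b = D (a * b) \<oplus> (D (- a) \<lhd> b)"
proof -
  have c: "D a \<lhd> b \<in> bm_carrier E" "a \<rhd> D b \<in> bm_carrier E"
    by (auto intro: right_closed left_closed D_closed)
  have "D (a * b) \<oplus> (D (- a) \<lhd> b) = (D a \<lhd> b) \<oplus> ((a \<rhd> D b) \<oplus> (-1) \<odot> (D a \<lhd> b))"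
    using c by (simp add: D_mult D_minus right_scale' D_closed add_assoc scale_closed)
  also have "\<dots> = (a \<rhd> D b) \<oplus> ((D a \<lhd> b) \<ominus> (D a \<lhd> b))"
    using c by (simp add: bm_diff_def add_left_commute scale_closed)
  finally show ?thesis using c by (simp add: diff_self add_zero)
qed

abbreviation "gsum \<equiv> derivation_sum E D"

lemma gsum_closed: "gsum l \<in> bm_carrier E"
  by (induction l) (auto intro!: zero_closed add_closed right_closed D_closed)

lemma gsum_append: "gsum (l @ l') = gsum l \<oplus> gsum l'"
  by (induction l) (auto simp: zero_add gsum_closed add_assoc add_closed right_closed D_closed)

lemma range_gsum_add: "\<lbrakk>x \<in> range gsum; y \<in> range gsum\<rbrakk> \<Longrightarrow> x \<oplus> y \<in> range gsum"
  by (auto simp flip: gsum_append)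

lemma gsum_D: "D a \<in> range gsum"
  by (rule range_eqI[of _ _ "[(a, 0, 0)]"]) (simp add: right_zero D_closed add_zero)

lemma gsum_D_right: "D b \<lhd> c \<in> range gsum"
  by (rule range_eqI[of _ _ "[(0, b, c)]"]) (simp add: D_zero D_closed right_closed add_zero zero_add)

lemma range_gsum_op:
  assumes Tc: "\<And>x y. \<lbrakk>x \<in> bm_carrier E; y \<in> bm_carrier E\<rbrakk> \<Longrightarrow> T (x \<oplus> y) = T x \<oplus> T y"
    and T0: "T \<zero> = \<zero>" and T1: "\<And>a. T (D a) \<in> range gsum" and T2: "\<And>b c. T (D b \<lhd> c) \<in> range gsum"
    and x: "x \<in> range gsum"
  shows "T x \<in> range gsum"
proof -
  have "T (gsum l) \<in> range gsum" for l
  proof (induction l)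
    case Nil
    show ?case by (rule range_eqI[of _ _ "[]"]) (simp add: T0)
  next
    case (Cons t ts)
    then show ?case
      by (simp add: Tc D_closed right_closed add_closed gsum_closed range_gsum_add T1 T2)
  qed
  then show ?thesis using x by auto
qed

lemma range_gsum_scale: "x \<in> range gsum \<Longrightarrow> c \<odot> x \<in> range gsum"
  by (rule range_gsum_op)
     (auto simp: scale_add_right scale_zero_right gsum_D gsum_D_right
       simp flip: D_scale right_scale[OF D_closed])

lemma range_gsum_right: "x \<in> range gsum \<Longrightarrow> x \<lhd> a \<in> range gsum"
  by (rule range_gsum_op[where T="\<lambda>x. x \<lhd> a"])
     (auto simp: right_add' zero_right gsum_D gsum_D_right simp flip: right_mult[OF D_closed])

lemma range_gsum_left: "x \<in> range gsum \<Longrightarrow> a \<rhd> x \<in> range gsum"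
proof (erule range_gsum_op[rotated -1])
  show L: "a \<rhd> D b \<in> range gsum" for b
    unfolding left_D by (intro range_gsum_add gsum_D gsum_D_right)
  show "a \<rhd> (D b \<lhd> c) \<in> range gsum" for b c
    unfolding left_right[OF D_closed] by (intro range_gsum_right L)
qed (auto simp: left_add' zero_left)

lemma derivation_is_inner:
  assumes "contractible_algebra TYPE('b)"
  shows "inner_derivation E D"
proof -
  define S where "S = bm_closure (range gsum)"
  define h :: "'e \<Rightarrow> 'b bimodule_universe" where
    "h x = (\<lambda>n. SOME l. \<nu> (gsum l \<ominus> x) < inverse (real (Suc n)))" for x
  have P: "range gsum \<subseteq> bm_carrier E" using gsum_closed by auto
  have Sc: "S \<subseteq> bm_carrier E" by (auto simp: S_def bm_closure_def)
  have h: "\<nu> (gsum (h x n) \<ominus> x) < inverse (real (Suc n))" if "x \<in> S" for x n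
  proof -
    have "\<exists>l. \<nu> (gsum l \<ominus> x) < inverse (real (Suc n))"
    proof -
      have "inverse (real (Suc n)) > 0" by simp
      then have "\<exists>p\<in>range gsum. \<nu> (p \<ominus> x) < inverse (real (Suc n))"
        using that unfolding S_def bm_closure_def by blast
      then show ?thesis by blast
    qed
    then show ?thesis unfolding h_def by (rule someI_ex)
  qed
  have inj: "inj_on h S"
  proof (rule inj_onI)
    fix x y assume xy: "x \<in> S" "y \<in> S" "h x = h y"
    then have c: "x \<in> bm_carrier E" "y \<in> bm_carrier E" using Sc by auto
    have le: "\<nu> (x \<ominus> y) < 2 * inverse (real (Suc n))" for n
    proof -
      have "\<nu> (x \<ominus> y) \<le> \<nu> (x \<ominus> gsum (h x n)) + \<nu> (gsum (h x n) \<ominus> y)"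
        by (intro norm_diff_triangle c gsum_closed)
      then show ?thesis
        using h[OF xy(1), of n] h[OF xy(2), of n] xy(3) norm_diff_commute[OF c(1) gsum_closed]
        by simp
    qed
    have "\<nu> (x \<ominus> y) = 0"
    proof (rule ccontr)
      assume "\<nu> (x \<ominus> y) \<noteq> 0"
      then have "\<nu> (x \<ominus> y) / 2 > 0" using norm_nonneg[OF diff_closed[OF c]] by simp
      then obtain n where "inverse (real (Suc n)) < \<nu> (x \<ominus> y) / 2" using reals_Archimedean by blast
      then show False using le[of n] by simp
    qed
    then show "x = y" using c diff_closed diff_eq_zero norm_eq_zero by blast
  qed
  obtain KL where KL: "\<And>a x. x \<in> bm_carrier E \<Longrightarrow> \<nu> (a \<rhd> x) \<le> KL * norm a * \<nu> x"
    using left_bounded by blast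
  obtain KR where KR: "\<And>a x. x \<in> bm_carrier E \<Longrightarrow> \<nu> (x \<lhd> a) \<le> KR * norm a * \<nu> x"
    using right_bounded by blast
  have PS: "range gsum \<subseteq> S" unfolding S_def by (rule subset_bm_closure[OF P])
  have S0: "\<zero> \<in> S" using PS range_eqI[of \<zero> gsum "[]"] by auto
  have S_add: "x \<oplus> y \<in> S" if "x \<in> S" "y \<in> S" for x y
    using that unfolding S_def by (intro bm_closure_add[OF P range_gsum_add])
  have S_scale: "c \<odot> x \<in> S" if "x \<in> S" for c x
    using that unfolding S_def
    by (intro bm_closure_op[where T="\<lambda>x. c \<odot> x" and K="norm c", OF P range_gsum_scale])
       (auto simp: scale_closed scale_diff norm_scale)
  have S_left: "a \<rhd> x \<in> S" if "x \<in> S" for a x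
    using that unfolding S_def
    by (intro bm_closure_op[where T="\<lambda>x. a \<rhd> x" and K="KL * norm a", OF P range_gsum_left])
       (auto simp: left_closed left_diff KL)
  have S_right: "x \<lhd> a \<in> S" if "x \<in> S" for a x
    using that unfolding S_def
    by (intro bm_closure_op[where T="\<lambda>x. x \<lhd> a" and K="KR * norm a", OF P range_gsum_right])
       (auto simp: right_closed right_diff KR)
  have S_lim: "l \<in> S" if "l \<in> bm_carrier E" "\<And>e. e > 0 \<Longrightarrow> \<exists>x\<in>S. \<nu> (x \<ominus> l) < e" for l
    using that unfolding S_def by (rule bm_closure_limit[OF P])
  note sim = bm_copy_simps[OF inj Sc S0 S_add S_scale S_left S_right S_lim]
  have DS: "D a \<in> S" for a using PS gsum_D by blast
  have "banach_bimodule (bm_copy S h)"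
    by (rule banach_bimodule_bm_copy[OF inj Sc S0 S_add S_scale S_left S_right S_lim])
  moreover have "derivation (bm_copy S h) (\<lambda>a. h (D a))"
    using der unfolding derivation_def by (auto simp: sim DS S_left S_right)
  ultimately have "inner_derivation (bm_copy S h) (\<lambda>a. h (D a))"
    using assms unfolding contractible_algebra_def by blast
  then obtain z where z: "z \<in> S" "\<And>a. h (D a) = h ((z \<lhd> a) \<ominus> (a \<rhd> z))"
    unfolding inner_derivation_def by (auto simp: sim S_left S_right)
  have "(z \<lhd> a) \<ominus> (a \<rhd> z) \<in> S" for a
    using z(1) by (simp add: bm_diff_def S_add S_scale S_left S_right)
  then have "D a = (z \<lhd> a) \<ominus> (a \<rhd> z)" for a
    using z(2) DS inj by (meson inj_onD)
  then show ?thesis unfolding inner_derivation_def using z(1) Sc by blast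
qed

end

theorem contractible_algebra_inner:
  fixes E :: "('b::complex_banach_algebra, 'e) bimodule"
  assumes "contractible_algebra TYPE('b)" "banach_bimodule E" "derivation E D"
  shows "inner_derivation E D"
proof -
  interpret banach_derivation E D
    using assms(2,3) by (simp add: banach_derivation_def banach_derivation_axioms_def)
  show ?thesis using assms(1) by (rule derivation_is_inner)
qed

end

theory Submission
  imports Defs
begin

text \<open>
  Two facts about an arbitrary Banach algebra carry the proof.

  A contractible algebra has only finitely many characters
  (\<open>contractible_finite_character_space\<close>).  Given infinitely many, choose a sequence
  \<open>\<kappa>\<^sub>0, \<kappa>\<^sub>1, \<dots>\<close> of distinct ones and let \<open>b\<close> act on matrices \<open>F\<close> indexed by pairs of naturals through
  \<open>(b F) i j = \<kappa>\<^sub>i b * F i j\<close> and \<open>(F b) i j = F i j * \<kappa>\<^sub>j b\<close>.  The map taking \<open>b\<close> to the matrix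
  \<open>\<kappa>\<^sub>i b - \<kappa>\<^sub>j b\<close> is a derivation, and an element \<open>z\<close> implementing it has to be \<open>-1\<close> off the
  diagonal.  In the bimodule of matrices that vanish on the diagonal and whose rows form a relatively
  compact set of bounded sequences this cannot happen: the rows of such a \<open>z\<close> have mutual
  distance at least 1.  This bimodule replaces the kernel of the multiplication on the projective
  tensor square.

  Contractibility passes from \<open>A\<close> to every algebra that is spanned by the ranges of finitely many
  mutually orthogonal homomorphisms from \<open>A\<close> (\<open>contractible_spanned_by_orthogonal_images\<close>).  A
  derivation is made to vanish on one range after the other by subtracting inner derivations.  A
  derivation that already vanishes on some of the ranges takes, on the next one, values in the
  annihilator of the former, so the element that corrects it there does no harm where it already
  vanishes.  One homomorphism alone gives the case of a surjective image.

  If \<open>X\<close> is finite, both function algebras are finite powers of \<open>A\<close>: point masses embed \<open>A\<close>,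
  evaluations project back.  These maps have second adjoints that are homomorphisms for the Arens
  product and satisfy the same identities, so the second duals are finite powers of the second dual
  of \<open>A\<close>.  The second fact then yields both equivalences with \<open>A\<close>
  (\<open>finite_power.contractible_iff\<close>).

  If \<open>X\<close> is infinite, a character \<open>\<phi>\<close> of \<open>A\<close> gives the characters \<open>f \<mapsto> \<phi> (f x)\<close>, which are
  distinct because functions vanishing at infinity separate points (Urysohn).  Evaluating elements
  of the second dual at characters gives as many characters of the second dual.  By the
  first fact none of the four algebras is contractible.
\<close>

section \<open>Bounded homomorphisms and characters\<close>

text \<open>
  The scalars have to be an instance so that matrices can be modelled as bounded functions with
  values in bounded functions, whose Banach algebra structure is then available.
\<close>

instantiation complex :: complex_banach_algebra
begin

definition scaleC_complex :: "complex \<Rightarrow> complex \<Rightarrow> complex" where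
  "scaleC_complex c x = c * x"

instance
  by standard (simp_all add: scaleC_complex_def algebra_simps norm_mult scaleR_conv_of_real)

end

locale bounded_clinear =
  fixes h :: "'a::complex_normed_vector \<Rightarrow> 'b::complex_normed_vector"
  assumes add: "h (x + y) = h x + h y"
    and scaleC: "h (c *\<^sub>C x) = c *\<^sub>C h x"
    and bounded: "\<exists>K. \<forall>x. norm (h x) \<le> K * norm x"

locale algebra_hom = bounded_clinear h
  for h :: "'a::complex_normed_algebra \<Rightarrow> 'b::complex_normed_algebra" +
  assumes mult: "h (x * y) = h x * h y"

text \<open>
  Automatic continuity.  If \<open>norm (\<phi> a) > norm a\<close>, rescale to an element \<open>b\<close> with \<open>\<phi> b = 1\<close> and
  \<open>norm b < 1\<close>.  The contraction \<open>x \<mapsto> b + b x\<close> has a fixed point \<open>x\<close> (the sum of the powers of \<open>b\<close>),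
  and applying \<open>\<phi>\<close> to it gives \<open>\<phi> x = 1 + \<phi> x\<close>.
\<close>

lemma character_norm_le:
  fixes \<phi> :: "'a::complex_banach_algebra \<Rightarrow> complex"
  assumes "\<phi> \<in> character_space"
  shows "norm (\<phi> a) \<le> norm a"
proof (rule ccontr)
  assume less: "\<not> norm (\<phi> a) \<le> norm a"
  then have nz: "\<phi> a \<noteq> 0" by auto
  have \<phi>: "\<phi> (x + y) = \<phi> x + \<phi> y" "\<phi> (c *\<^sub>C x) = c * \<phi> x" "\<phi> (x * y) = \<phi> x * \<phi> y" for x y c
    using assms by (auto simp: character_space_def)
  define b where "b = inverse (\<phi> a) *\<^sub>C a"
  have b: "\<phi> b = 1" "norm b < 1"
    using less nz by (simp_all add: b_def \<phi> norm_scaleC norm_divide field_simps)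
  have "dist (b + b * x) (b + b * y) \<le> norm b * dist x y" for x y
    by (simp add: dist_norm norm_mult_ineq flip: right_diff_distrib)
  then obtain x where "b + b * x = x"
    using banach_fix_type[of "norm b" "\<lambda>x. b + b * x"] b(2) by auto
  then show False
    using \<phi>(1)[of b "b * x"] by (simp add: \<phi>(3) b(1))
qed


section \<open>Contractible algebras have finitely many characters\<close>

text \<open>
  Two homomorphisms \<open>L\<close> and \<open>R\<close> into a Banach algebra make it a bimodule, with left action through \<open>L\<close>
  and right action through \<open>R\<close>; \<open>S\<close> is meant to be a closed subspace that is stable under both.
\<close>

definition subspace_bimodule ::
    "'c::complex_banach_algebra set \<Rightarrow> ('b \<Rightarrow> 'c) \<Rightarrow> ('b \<Rightarrow> 'c) \<Rightarrow> ('b, 'c) bimodule" where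
  "subspace_bimodule S L R = \<lparr>bm_carrier = S, bm_zero = 0, bm_add = (+), bm_scale = scaleC,
     bm_norm = norm, bm_left = \<lambda>b x. L b * x, bm_right = \<lambda>x b. x * R b\<rparr>"

lemma subspace_bimodule_diff:
  "x \<ominus>\<^bsub>subspace_bimodule S L R\<^esub> y = x - y"
  by (simp add: bm_diff_def subspace_bimodule_def scaleC_minus_one)

lemma banach_bimodule_subspace:
  assumes L: "algebra_hom L" and R: "algebra_hom R"
    and S: "0 \<in> S" "\<And>x y. \<lbrakk>x \<in> S; y \<in> S\<rbrakk> \<Longrightarrow> x + y \<in> S" "\<And>c x. x \<in> S \<Longrightarrow> c *\<^sub>C x \<in> S" "closed S"
    and act: "\<And>b x. x \<in> S \<Longrightarrow> L b * x \<in> S" "\<And>b x. x \<in> S \<Longrightarrow> x * R b \<in> S"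
  shows "banach_bimodule (subspace_bimodule S L R)"
proof -
  interpret L: algebra_hom L by (rule L)
  interpret R: algebra_hom R by (rule R)
  have bound: "\<exists>K. \<forall>a. \<forall>x. norm (T a x) \<le> K * norm a * norm x"
    if "\<exists>K. \<forall>a. norm (h a) \<le> K * norm a" "\<And>a x. norm (T a x) \<le> norm (h a) * norm x"
    for h :: "'a \<Rightarrow> 'b" and T :: "'a \<Rightarrow> 'b \<Rightarrow> 'b"
  proof -
    obtain K where "\<And>a. norm (h a) \<le> K * norm a" using \<open>\<exists>K. _\<close> by blast
    then have "norm (T a x) \<le> K * norm a * norm x" for a x
      using that(2)[of a x] by (meson mult_right_mono norm_ge_zero order_trans)
    then show ?thesis by blast
  qed
  show ?thesis
  proof (unfold_locales, unfold subspace_bimodule_diff)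
    fix s :: "nat \<Rightarrow> 'b"
    assume s: "range s \<subseteq> bm_carrier (subspace_bimodule S L R)"
      "\<forall>e>0. \<exists>N. \<forall>m\<ge>N. \<forall>n\<ge>N. bm_norm (subspace_bimodule S L R) (s m - s n) < e"
    then have "Cauchy s"
      by (simp add: Cauchy_def dist_norm subspace_bimodule_def)
    then obtain l where l: "s \<longlonglongrightarrow> l" using Cauchy_convergent convergent_def by blast
    then have "l \<in> S"
      using closed_sequentially[OF S(4), of s l] s(1) by (auto simp: subspace_bimodule_def)
    with l show "\<exists>l\<in>bm_carrier (subspace_bimodule S L R).
        \<forall>e>0. \<exists>N. \<forall>n\<ge>N. bm_norm (subspace_bimodule S L R) (s n - l) < e"
      by (auto simp: lim_sequentially dist_norm subspace_bimodule_def)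
  next
    fix x assume "x \<in> bm_carrier (subspace_bimodule S L R)"
    then show "\<exists>y\<in>bm_carrier (subspace_bimodule S L R).
        x \<oplus>\<^bsub>subspace_bimodule S L R\<^esub> y = \<zero>\<^bsub>subspace_bimodule S L R\<^esub>"
      using S(3)[of x "-1"]
      by (intro bexI[of _ "- x"]) (simp_all add: subspace_bimodule_def scaleC_minus_one)
  next
    have "\<exists>K. \<forall>a. \<forall>x. norm (L a * x) \<le> K * norm a * norm x"
      by (rule bound[OF L.bounded]) (rule norm_mult_ineq)
    then show "\<exists>K. \<forall>a. \<forall>x\<in>bm_carrier (subspace_bimodule S L R).
        bm_norm (subspace_bimodule S L R) (a \<rhd>\<^bsub>subspace_bimodule S L R\<^esub> x)
        \<le> K * norm a * bm_norm (subspace_bimodule S L R) x"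
      by (auto simp: subspace_bimodule_def)
  next
    have "norm (x * R a) \<le> norm (R a) * norm x" for a x
      by (metis mult.commute norm_mult_ineq)
    then have "\<exists>K. \<forall>a. \<forall>x. norm (x * R a) \<le> K * norm a * norm x"
      by (intro bound[OF R.bounded])
    then show "\<exists>K. \<forall>a. \<forall>x\<in>bm_carrier (subspace_bimodule S L R).
        bm_norm (subspace_bimodule S L R) (x \<lhd>\<^bsub>subspace_bimodule S L R\<^esub> a)
        \<le> K * norm a * bm_norm (subspace_bimodule S L R) x"
      by (auto simp: subspace_bimodule_def)
  qed (auto simp: subspace_bimodule_def S act L.add L.scaleC L.mult R.add R.scaleC R.mult
      algebra_simps scaleC_add_right scaleC_add_left scaleC_scaleC scaleC_one norm_scaleC
      norm_triangle_ineq mult_scaleC_left mult_scaleC_right)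
qed

text \<open>
  The Leibniz rule is the identity \<open>L a L b - R a R b = (L a - R a) R b + L a (L b - R b)\<close>.
\<close>

lemma derivation_hom_difference:
  assumes L: "algebra_hom L" and R: "algebra_hom R" and S: "\<And>b. L b - R b \<in> S"
  shows "derivation (subspace_bimodule S L R) (\<lambda>b. L b - R b)"
proof -
  interpret L: algebra_hom L by (rule L)
  interpret R: algebra_hom R by (rule R)
  obtain K1 K2 where "\<And>x. norm (L x) \<le> K1 * norm x" "\<And>x. norm (R x) \<le> K2 * norm x"
    using L.bounded R.bounded by blast
  then have "norm (L x - R x) \<le> (K1 + K2) * norm x" for x
    using norm_triangle_ineq4[of "L x" "R x"] by (smt (verit) distrib_right)
  then have "\<exists>K. \<forall>x. norm (L x - R x) \<le> K * norm x" by blast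
  then show ?thesis
    using S by (auto simp: derivation_def subspace_bimodule_def L.add L.scaleC L.mult R.add R.scaleC
        R.mult algebra_simps scaleC_diff_right)
qed

definition compact_range :: "('x::topological_space \<Rightarrow>\<^sub>C 'c::metric_space) \<Rightarrow> bool" where
  "compact_range F \<longleftrightarrow> (\<exists>K. compact K \<and> range (apply_bcontfun F) \<subseteq> K)"

text \<open>
  Continuous operations preserve relatively compact ranges, because the values lie in a continuous
  image of a product of two compact sets.
\<close>

lemma compact_range_combine:
  assumes "compact_range F" "compact_range G"
    and cont: "continuous_on UNIV (\<lambda>p. f (fst p) (snd p))"
    and H: "\<And>x. apply_bcontfun H x = f (F x) (G x)"
  shows "compact_range H"
proof -
  obtain K K' where K: "compact K" "range (apply_bcontfun F) \<subseteq> K"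
      "compact K'" "range (apply_bcontfun G) \<subseteq> K'"
    using assms(1,2) unfolding compact_range_def by blast
  from K have "compact ((\<lambda>p. f (fst p) (snd p)) ` (K \<times> K'))"
    by (intro compact_continuous_image continuous_on_subset[OF cont] compact_Times) auto
  moreover have "range (apply_bcontfun H) \<subseteq> (\<lambda>p. f (fst p) (snd p)) ` (K \<times> K')"
  proof (rule image_subsetI)
    show "H x \<in> (\<lambda>p. f (fst p) (snd p)) ` (K \<times> K')" for x
      using K(2,4) by (intro image_eqI[of _ _ "(F x, G x)"]) (auto simp: H)
  qed
  ultimately show ?thesis
    unfolding compact_range_def by blast
qed

lemma compact_range_add: "\<lbrakk>compact_range F; compact_range G\<rbrakk> \<Longrightarrow> compact_range (F + G)"
  for F G :: "'x::topological_space \<Rightarrow>\<^sub>C 'c::complex_normed_algebra"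
  by (rule compact_range_combine[where f="(+)" and F=F and G=G]) (auto intro!: continuous_intros)

lemma compact_range_diff: "\<lbrakk>compact_range F; compact_range G\<rbrakk> \<Longrightarrow> compact_range (F - G)"
  for F G :: "'x::topological_space \<Rightarrow>\<^sub>C 'c::complex_normed_algebra"
  by (rule compact_range_combine[where f="(-)" and F=F and G=G]) (auto intro!: continuous_intros)

lemma compact_range_times: "\<lbrakk>compact_range F; compact_range G\<rbrakk> \<Longrightarrow> compact_range (F * G)"
  for F G :: "'x::topological_space \<Rightarrow>\<^sub>C 'c::complex_normed_algebra"
  by (rule compact_range_combine[where f="(*)" and F=F and G=G]) (auto intro!: continuous_intros)

lemma compact_range_scaleC: "compact_range F \<Longrightarrow> compact_range (c *\<^sub>C F)"
  for F :: "'x::topological_space \<Rightarrow>\<^sub>C 'c::complex_normed_algebra"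
  by (rule compact_range_combine[where f="\<lambda>x y. c *\<^sub>C x" and F=F and G=F])
     (auto intro!: continuous_intros bounded_linear.continuous_on[OF bounded_linear_scaleC])

lemma closed_Collect_sequentially:
  fixes P :: "'c::metric_space \<Rightarrow> bool"
  assumes "\<And>s l. \<lbrakk>\<And>n. P (s n); s \<longlonglongrightarrow> l\<rbrakk> \<Longrightarrow> P l"
  shows "closed {x. P x}"
  unfolding closed_sequential_limits 
proof (intro allI impI, elim conjE)
  fix s l assume "\<forall>n. s n \<in> {x. P x}" "s \<longlonglongrightarrow> l"
  then show "l \<in> {x. P x}" using assms[of s l] by simp
qed

text \<open>
  A finite net for the values of a function close to the limit is, with a slightly larger radius, a
  finite net for the values of the limit.
\<close>

lemma closed_compact_range:
  "closed {F :: 'x::topological_space \<Rightarrow>\<^sub>C 'c::complete_space. compact_range F}"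
proof (rule closed_Collect_sequentially)
  fix F and G :: "'x \<Rightarrow>\<^sub>C 'c"
  assume F: "\<And>n. compact_range (F n)" and lim: "F \<longlonglongrightarrow> G"
  have "\<exists>k. finite k \<and> closure (range (apply_bcontfun G)) \<subseteq> (\<Union>c\<in>k. ball c e)" if "e > 0" for e
  proof -
    have e: "e / 3 > 0" using \<open>e > 0\<close> by simp
    obtain n where n: "dist (F n) G < e / 3" using lim e unfolding lim_sequentially by blast
    obtain K where K: "compact K" "range (apply_bcontfun (F n)) \<subseteq> K"
      using F unfolding compact_range_def by blast
    obtain k where k: "finite k" "K \<subseteq> (\<Union>c\<in>k. ball c (e / 3))"
      using K(1) e unfolding compact_eq_totally_bounded by blast
    have "G x \<in> (\<Union>c\<in>k. cball c (2 * e / 3))" for x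
    proof -
      obtain c where "c \<in> k" "dist c (F n x) < e / 3" 
        using subsetD[OF k(2) subsetD[OF K(2) rangeI[of _ x]]] by auto
      moreover have "dist (F n x) (G x) < e / 3" using dist_bounded[of "F n" x G] n by simp
      ultimately show ?thesis using dist_triangle[of c "G x" "F n x"] by force
    qed
    then have "range (apply_bcontfun G) \<subseteq> (\<Union>c\<in>k. cball c (2 * e / 3))" by blast
    moreover have "closed (\<Union>c\<in>k. cball c (2 * e / 3))"
      by (intro closed_UN ballI closed_cball k(1))
    ultimately have "closure (range (apply_bcontfun G)) \<subseteq> (\<Union>c\<in>k. cball c (2 * e / 3))"
      by (rule closure_minimal)
    also have "\<dots> \<subseteq> (\<Union>c\<in>k. ball c e)"
    proof (rule UN_mono[OF order_refl])
      show "cball c (2 * e / 3) \<subseteq> ball c e" for c :: 'c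
        using \<open>e > 0\<close> by (simp add: subset_iff)
    qed
    finally show ?thesis using k(1) by blast
  qed
  then have K: "compact (closure (range (apply_bcontfun G)))"
    unfolding compact_eq_totally_bounded complete_eq_closed by (intro conjI closed_closure allI impI)
  show "compact_range G"
    unfolding compact_range_def by (rule exI, rule conjI, rule K, rule closure_subset)
qed

text \<open>
  Matrices are functions of the row index with values in the bounded functions of the column index,
  so that \<open>compact_range\<close> speaks about the set of rows.
\<close>

theorem contractible_finite_character_space:
  assumes "contractible_algebra TYPE('b::complex_banach_algebra)"
  shows "finite (character_space :: ('b \<Rightarrow> complex) set)"
proof (rule ccontr)
  assume "\<not> ?thesis"
  then obtain \<kappa> :: "nat \<Rightarrow> 'b \<Rightarrow> complex" where inj: "inj \<kappa>" and \<kappa>: "\<And>i. \<kappa> i \<in> character_space"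
    by (metis infinite_countable_subset range_subsetD)
  have \<kappa>_simps: "\<kappa> i (x + y) = \<kappa> i x + \<kappa> i y" "\<kappa> i (c *\<^sub>C x) = c * \<kappa> i x" "\<kappa> i (x * y) = \<kappa> i x * \<kappa> i y"
    for i x y c
    using \<kappa>[of i] by (auto simp: character_space_def)
  note le = character_norm_le[OF \<kappa>]
  define R1 :: "'b \<Rightarrow> nat \<Rightarrow>\<^sub>C complex" where "R1 b = Bcontfun (\<lambda>j. \<kappa> j b)" for b
  define R :: "'b \<Rightarrow> nat \<Rightarrow>\<^sub>C nat \<Rightarrow>\<^sub>C complex" where "R b = const_bcontfun (R1 b)" for b
  define L :: "'b \<Rightarrow> nat \<Rightarrow>\<^sub>C nat \<Rightarrow>\<^sub>C complex" where
    "L b = Bcontfun (\<lambda>i. const_bcontfun (\<kappa> i b))" for b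
  have R1: "R1 b j = \<kappa> j b" for b j
    unfolding R1_def
    by (subst Bcontfun_inverse) (auto intro!: bcontfun_normI[where b="norm b"] le)
  have R [simp]: "R b i j = \<kappa> j b" for b i j by (simp add: R_def R1)
  have norm_const: "norm (const_bcontfun c :: nat \<Rightarrow>\<^sub>C complex) \<le> norm c" for c
    by (rule norm_bound) simp
  have L1: "L b i = const_bcontfun (\<kappa> i b)" for b i
    unfolding L_def
    by (subst Bcontfun_inverse)
       (auto intro!: bcontfun_normI[where b="norm b"] order_trans[OF norm_const] le)
  then have L [simp]: "L b i j = \<kappa> i b" for b i j by simp
  have L_hom: "algebra_hom L"
  proof
    have "norm (L b) \<le> 1 * norm b" for b
      by (intro norm_bound) (simp add: le)
    then show "\<exists>K. \<forall>b. norm (L b) \<le> K * norm b" by blast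
  qed (auto intro!: bcontfun_eqI simp: \<kappa>_simps scaleC_complex_def)
  have R_hom: "algebra_hom R"
  proof
    have "norm (R b) \<le> 1 * norm b" for b
      by (intro norm_bound) (simp add: le)
    then show "\<exists>K. \<forall>b. norm (R b) \<le> K * norm b" by blast
  qed (auto intro!: bcontfun_eqI simp: \<kappa>_simps scaleC_complex_def)
  define S where "S = {F :: nat \<Rightarrow>\<^sub>C nat \<Rightarrow>\<^sub>C complex. compact_range F} \<inter>
    {F. \<forall>i. apply_bcontfun (apply_bcontfun F i) i = 0}"
  \<comment> \<open>the rows of \<open>L b\<close> are constants from a disc\<close>
  have cL: "compact_range (L b)" for b
  proof -
    have "continuous_on UNIV (const_bcontfun :: complex \<Rightarrow> nat \<Rightarrow>\<^sub>C complex)"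
    proof (rule continuous_onI)
      fix c :: complex and e :: real
      assume "e > 0"
      moreover have "dist (const_bcontfun c' :: nat \<Rightarrow>\<^sub>C complex) (const_bcontfun c) \<le> dist c' c" for c'
        by (rule dist_bound) simp
      ultimately show "\<exists>d>0. \<forall>c'\<in>UNIV. dist c' c < d \<longrightarrow>
          dist (const_bcontfun c' :: nat \<Rightarrow>\<^sub>C complex) (const_bcontfun c) \<le> e"
        by (intro exI[of _ e]) (meson less_imp_le order_trans)
    qed
    then have "compact ((const_bcontfun :: complex \<Rightarrow> nat \<Rightarrow>\<^sub>C complex) ` cball 0 (norm b))"
      by (intro compact_continuous_image compact_cball) (erule continuous_on_subset, rule subset_UNIV)
    moreover have "range (apply_bcontfun (L b)) \<subseteq> const_bcontfun ` cball 0 (norm b)"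
      using le by (auto simp: L1)
    ultimately show ?thesis unfolding compact_range_def by blast
  qed
  have cR: "compact_range (R b)" for b
    unfolding compact_range_def by (rule exI[of _ "{R1 b}"]) (auto simp: R_def)
  have c0: "compact_range (0 :: nat \<Rightarrow>\<^sub>C nat \<Rightarrow>\<^sub>C complex)"
    unfolding compact_range_def by (rule exI[of _ "{0}"]) auto
  have closed_diag: "closed {F :: nat \<Rightarrow>\<^sub>C nat \<Rightarrow>\<^sub>C complex. \<forall>i. apply_bcontfun (apply_bcontfun F i) i = 0}"
  proof (rule closed_Collect_sequentially, intro allI, rule ccontr)
    fix i and F and G :: "nat \<Rightarrow>\<^sub>C nat \<Rightarrow>\<^sub>C complex"
    assume F: "\<And>n. \<forall>i. apply_bcontfun (apply_bcontfun (F n) i) i = 0" and lim: "F \<longlonglongrightarrow> G"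
    assume "G i i \<noteq> 0"
    then obtain n where "dist (F n) G < norm (G i i)"
      using lim unfolding lim_sequentially by (metis order_refl zero_less_norm_iff)
    then have "dist (F n i i) (G i i) < norm (G i i)"
      by (intro dist_fun_lt_imp_dist_val_lt)
    then show False using F by (simp add: dist_norm)
  qed
  have "banach_bimodule (subspace_bimodule S L R)"
  proof (rule banach_bimodule_subspace[OF L_hom R_hom])
    show "closed S" unfolding S_def by (intro closed_Int closed_compact_range closed_diag)
    show "0 \<in> S" by (simp add: S_def c0)
    show "F + G \<in> S" if "F \<in> S" "G \<in> S" for F G
      using that by (simp add: S_def compact_range_add)
    show "c *\<^sub>C F \<in> S" if "F \<in> S" for F c
      using that by (simp add: S_def compact_range_scaleC scaleC_complex_def)
    show "L b * F \<in> S" if "F \<in> S" for F b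
      using that by (simp add: S_def compact_range_times cL)
    show "F * R b \<in> S" if "F \<in> S" for F b
      using that by (simp add: S_def compact_range_times cR)
  qed
  moreover have "derivation (subspace_bimodule S L R) (\<lambda>b. L b - R b)"
    by (rule derivation_hom_difference[OF L_hom R_hom]) (simp add: S_def compact_range_diff cL cR)
  ultimately have "inner_derivation (subspace_bimodule S L R) (\<lambda>b. L b - R b)"
    by (rule contractible_algebra_inner[OF assms])
  then obtain z where z: "z \<in> S" "\<And>b. L b - R b = z * R b - L b * z"
    unfolding inner_derivation_def subspace_bimodule_diff by (auto simp: subspace_bimodule_def)
  \<comment> \<open>\<open>b\<close> is any element on which \<open>\<kappa> i\<close> and \<open>\<kappa> j\<close> differ; their difference cancels\<close>
  have off: "z i j = -1" if ij: "i \<noteq> j" for i j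
  proof -
    obtain b where b: "\<kappa> i b \<noteq> \<kappa> j b" using inj ij by (metis injD ext)
    have "(L b - R b) i j = (z * R b - L b * z) i j" using z(2) by simp
    then have "(\<kappa> i b - \<kappa> j b) * (z i j + 1) = 0" by (simp add: algebra_simps)
    then show ?thesis using b by (simp add: eq_neg_iff_add_eq_0)
  qed
  have sep: "1 \<le> dist (z i) (z i')" if "i \<noteq> i'" for i i'
  proof -
    have "z i' i' = 0" using z(1) by (simp add: S_def)
    then show ?thesis
      using dist_bounded[of "z i" i' "z i'"] off[OF that] by (simp add: dist_norm)
  qed
  obtain K where K: "compact K" "range (apply_bcontfun z) \<subseteq> K"
    using z(1) by (auto simp: S_def compact_range_def)
  \<comment> \<open>a ball of radius 1/2 contains at most one of the infinitely many rows\<close>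
  obtain k where k: "finite k" "K \<subseteq> (\<Union>c\<in>k. ball c (1/2))"
    using K(1) unfolding compact_eq_totally_bounded by (meson half_gt_zero zero_less_one)
  have "\<forall>i. \<exists>c\<in>k. dist c (z i) < 1/2" using K(2) k(2) by (auto simp: subset_iff)
  then obtain c where c: "\<And>i. c i \<in> k" "\<And>i. dist (c i) (z i) < 1/2" by metis
  have "inj c"
  proof (rule injI, rule ccontr)
    fix i i' assume "c i = c i'" "i \<noteq> i'"
    then show False
      using sep[of i i'] c(2)[of i] c(2)[of i'] dist_triangle3[of "z i" "z i'" "c i"] by simp
  qed
  then show False
    using c(1) k(1) finite_subset[of "range c" k] finite_imageD[of c UNIV] by auto
qed


section \<open>Derivations on algebras spanned by orthogonal homomorphic images\<close>

context banach_bimodule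
begin

abbreviation ad :: "'e \<Rightarrow> 'b \<Rightarrow> 'e" where
  "ad z a \<equiv> (z \<lhd> a) \<ominus> (a \<rhd> z)"

lemma norm_diff_le: "\<lbrakk>x \<in> bm_carrier E; y \<in> bm_carrier E\<rbrakk> \<Longrightarrow> \<nu> (x \<ominus> y) \<le> \<nu> x + \<nu> y"
  unfolding bm_diff_def using norm_triangle[of x "(-1) \<odot> y"] norm_scale[of y "-1"] scale_closed
  by simp

lemma bounded_diff:
  assumes "\<exists>K. \<forall>a. \<nu> (S a) \<le> K * norm a" "\<exists>K. \<forall>a. \<nu> (T a) \<le> K * norm a"
    and "\<And>a. S a \<in> bm_carrier E" "\<And>a. T a \<in> bm_carrier E"
  shows "\<exists>K. \<forall>a :: 'b. \<nu> (S a \<ominus> T a) \<le> K * norm a"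
proof -
  obtain K L where "\<And>a. \<nu> (S a) \<le> K * norm a" "\<And>a. \<nu> (T a) \<le> L * norm a"
    using assms(1,2) by blast
  then have "\<nu> (S a \<ominus> T a) \<le> (K + L) * norm a" for a
    using norm_diff_le[OF assms(3,4), of a a] by (smt (verit) distrib_right)
  then show ?thesis by blast
qed

lemma derivation_ad:
  assumes z: "z \<in> bm_carrier E"
  shows "derivation E (ad z)"
proof -
  have c: "z \<lhd> a \<in> bm_carrier E" "a \<rhd> z \<in> bm_carrier E" for a
    using z by (simp_all add: left_closed right_closed)
  obtain K L where K: "\<And>a. \<nu> (a \<rhd> z) \<le> K * norm a * \<nu> z" and L: "\<And>a. \<nu> (z \<lhd> a) \<le> L * norm a * \<nu> z"
    using left_bounded right_bounded z by blast
  have "\<exists>K. \<forall>a. \<nu> (ad z a) \<le> K * norm a"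
  proof (rule bounded_diff)
    show "\<exists>K. \<forall>a. \<nu> (z \<lhd> a) \<le> K * norm a"
      using L by (intro exI[of _ "L * \<nu> z"]) (simp add: mult_ac)
    show "\<exists>K. \<forall>a. \<nu> (a \<rhd> z) \<le> K * norm a"
      using K by (intro exI[of _ "K * \<nu> z"]) (simp add: mult_ac)
  qed (rule c)+
  moreover have "ad z (a * b) = (ad z a \<lhd> b) \<oplus> (a \<rhd> ad z b)" for a b
    using z c
    by (simp add: right_diff left_diff right_mult left_mult left_right diff_add_diff left_closed right_closed)
  ultimately show ?thesis
    using z c
    by (auto simp: derivation_def diff_closed left_add right_add add_diff_add left_scale right_scale
        scale_diff)
qed

lemma derivation_diff:
  assumes D: "derivation E D" and D': "derivation E D'"
  shows "derivation E (\<lambda>a. D a \<ominus> D' a)"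
proof -
  have c: "D a \<in> bm_carrier E" "D' a \<in> bm_carrier E" for a
    using D D' by (auto simp: derivation_def)
  have "\<exists>K. \<forall>a. \<nu> (D a \<ominus> D' a) \<le> K * norm a"
    using D D' by (intro bounded_diff c) (auto simp: derivation_def)
  moreover have "D (a * b) \<ominus> D' (a * b) = ((D a \<ominus> D' a) \<lhd> b) \<oplus> (a \<rhd> (D b \<ominus> D' b))" for a b
    using D D' c
    by (simp add: derivation_def right_diff left_diff add_diff_add left_closed right_closed)
  ultimately show ?thesis
    using D D' c by (auto simp: derivation_def diff_closed add_diff_add scale_diff)
qed

text \<open>
  The set \<open>J\<close> stands for the part of the algebra on which a derivation has already been corrected.
\<close>

definition annihilator :: "'b set \<Rightarrow> 'e set" where
  "annihilator J = {x \<in> bm_carrier E. \<forall>b\<in>J. b \<rhd> x = \<zero> \<and> x \<lhd> b = \<zero>}"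

lemma zero_actions: "a \<rhd> \<zero> = \<zero>" "\<zero> \<lhd> a = \<zero>"
  using left_scale'[OF zero_closed, of a 0] right_scale'[OF zero_closed, of 0 a]
  by (simp_all add: scale_zero_left scale_zero_right left_closed right_closed zero_closed)

lemma diff_zero: "x \<in> bm_carrier E \<Longrightarrow> x \<ominus> \<zero> = x"
  by (simp add: bm_diff_def scale_zero_right add_zero)

text \<open>
  The annihilator is closed, being an intersection of kernels of bounded additive maps.
\<close>

lemma annihilator_limit:
  assumes l: "l \<in> bm_carrier E" and s: "\<And>e. e > 0 \<Longrightarrow> \<exists>x\<in>annihilator J. \<nu> (x \<ominus> l) < e"
  shows "l \<in> annihilator J"
proof -
  have zero: "T l = \<zero>"
    if T: "\<And>x. x \<in> bm_carrier E \<Longrightarrow> T x \<in> bm_carrier E"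
        "\<And>x y. \<lbrakk>x \<in> bm_carrier E; y \<in> bm_carrier E\<rbrakk> \<Longrightarrow> T (x \<ominus> y) = T x \<ominus> T y"
        "\<And>x. x \<in> bm_carrier E \<Longrightarrow> \<nu> (T x) \<le> K * \<nu> x"
      and ann: "\<And>x. x \<in> annihilator J \<Longrightarrow> T x = \<zero>" for T :: "'e \<Rightarrow> 'e" and K
  proof (rule ccontr)
    assume "T l \<noteq> \<zero>"
    then have pos: "\<nu> (T l) > 0"
      using norm_eq_zero norm_nonneg T(1) l by (metis less_eq_real_def)
    then have "\<nu> (T l) / (\<bar>K\<bar> + 1) > 0" by (simp add: add_nonneg_pos)
    then obtain x where x: "x \<in> annihilator J" "\<nu> (x \<ominus> l) < \<nu> (T l) / (\<bar>K\<bar> + 1)" using s by blast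
    have xc: "x \<in> bm_carrier E" using x(1) by (simp add: annihilator_def)
    have "\<nu> (T l) = \<nu> (T l \<ominus> T x)" using ann[OF x(1)] T(1)[OF l] by (simp add: diff_zero)
    also have "\<dots> = \<nu> (T (x \<ominus> l))" using xc l by (simp add: T norm_diff_commute)
    also have "\<dots> \<le> K * \<nu> (x \<ominus> l)" using xc l by (simp add: T(3) diff_closed)
    also have "\<dots> \<le> (\<bar>K\<bar> + 1) * \<nu> (x \<ominus> l)"
      by (rule mult_right_mono) (auto intro: norm_nonneg diff_closed xc l)
    also have "\<dots> < \<nu> (T l)" using x(2) by (simp add: field_simps add_nonneg_pos)
    finally show False by simp
  qed
  obtain KL where KL: "\<And>a x. x \<in> bm_carrier E \<Longrightarrow> \<nu> (a \<rhd> x) \<le> KL * norm a * \<nu> x"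
    using left_bounded by blast
  obtain KR where KR: "\<And>a x. x \<in> bm_carrier E \<Longrightarrow> \<nu> (x \<lhd> a) \<le> KR * norm a * \<nu> x"
    using right_bounded by blast
  have "b \<rhd> l = \<zero>" if "b \<in> J" for b
    using that by (intro zero[of "\<lambda>x. b \<rhd> x" "KL * norm b"]) (auto simp: left_closed left_diff KL annihilator_def)
  moreover have "l \<lhd> b = \<zero>" if "b \<in> J" for b
    using that
    by (intro zero[of "\<lambda>x. x \<lhd> b" "KR * norm b"])
       (auto simp: right_closed right_diff KR annihilator_def)
  ultimately show ?thesis using l by (simp add: annihilator_def)
qed

text \<open>
  Restriction of scalars along \<open>h\<close>, on the part \<open>S\<close> of the carrier.
\<close>

definition pullback :: "'e set \<Rightarrow> ('a \<Rightarrow> 'b) \<Rightarrow> ('a, 'e) bimodule" where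
  "pullback S h = \<lparr>bm_carrier = S, bm_zero = \<zero>, bm_add = (\<oplus>), bm_scale = (\<odot>), bm_norm = bm_norm E,
     bm_left = \<lambda>a x. h a \<rhd> x, bm_right = \<lambda>x a. x \<lhd> h a\<rparr>"

lemma pullback_diff: "x \<ominus>\<^bsub>pullback S h\<^esub> y = x \<ominus> y"
  by (simp add: bm_diff_def pullback_def)

lemma banach_bimodule_pullback:
  fixes h :: "'a::complex_banach_algebra \<Rightarrow> 'b"
  assumes h: "algebra_hom h" and S: "S \<subseteq> bm_carrier E"
    and S0: "\<zero> \<in> S" and S_add: "\<And>x y. \<lbrakk>x \<in> S; y \<in> S\<rbrakk> \<Longrightarrow> x \<oplus> y \<in> S"
    and S_scale: "\<And>c x. x \<in> S \<Longrightarrow> c \<odot> x \<in> S"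
    and S_left: "\<And>a x. x \<in> S \<Longrightarrow> h a \<rhd> x \<in> S" and S_right: "\<And>a x. x \<in> S \<Longrightarrow> x \<lhd> h a \<in> S"
    and S_lim: "\<And>l. \<lbrakk>l \<in> bm_carrier E; \<And>e. e > 0 \<Longrightarrow> \<exists>x\<in>S. \<nu> (x \<ominus> l) < e\<rbrakk> \<Longrightarrow> l \<in> S"
  shows "banach_bimodule (pullback S h)"
proof -
  interpret h: algebra_hom h by (rule h)
  have Sc: "x \<in> S \<Longrightarrow> x \<in> bm_carrier E" for x using S by blast
  have sim: "bm_carrier (pullback S h) = S" "\<zero>\<^bsub>pullback S h\<^esub> = \<zero>"
    "x \<oplus>\<^bsub>pullback S h\<^esub> y = x \<oplus> y" "c \<odot>\<^bsub>pullback S h\<^esub> x = c \<odot> x" "\<nu>\<^bsub>pullback S h\<^esub> x = \<nu> x"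
    "a \<rhd>\<^bsub>pullback S h\<^esub> x = h a \<rhd> x" "x \<lhd>\<^bsub>pullback S h\<^esub> a = x \<lhd> h a" for x y c a
    by (simp_all add: pullback_def)
  obtain H where H: "\<And>a. norm (h a) \<le> H * norm a" using h.bounded by blast
  have bound: "\<exists>K'. \<forall>a. \<forall>x\<in>S. \<nu> (T (h a) x) \<le> K' * norm a * \<nu> x"
    if T: "\<And>b x. x \<in> S \<Longrightarrow> \<nu> (T b x) \<le> K * norm b * \<nu> x" for K and T :: "'b \<Rightarrow> 'e \<Rightarrow> 'e"
  proof (intro exI ballI allI)
    fix a x assume x: "x \<in> S"
    have "\<nu> (T (h a) x) \<le> K * norm (h a) * \<nu> x" by (rule T[OF x])
    also have "\<dots> \<le> \<bar>K\<bar> * (H * norm a) * \<nu> x"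
      by (intro mult_right_mono mult_mono norm_nonneg H Sc x) auto
    finally show "\<nu> (T (h a) x) \<le> (\<bar>K\<bar> * H) * norm a * \<nu> x" by (simp add: mult.assoc)
  qed
  show ?thesis
  proof (unfold_locales, unfold pullback_diff, unfold sim)
    fix s :: "nat \<Rightarrow> 'e"
    assume s: "range s \<subseteq> S" "\<forall>e>0. \<exists>N. \<forall>m\<ge>N. \<forall>n\<ge>N. \<nu> (s m \<ominus> s n) < e"
    then obtain l where l: "l \<in> bm_carrier E" "\<forall>e>0. \<exists>N. \<forall>n\<ge>N. \<nu> (s n \<ominus> l) < e"
      using complete[of s] S by blast
    have "l \<in> S" using l s(1) by (intro S_lim) blast+
    with l show "\<exists>l\<in>S. \<forall>e>0. \<exists>N. \<forall>n\<ge>N. \<nu> (s n \<ominus> l) < e" by blast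
  next
    fix x assume x: "x \<in> S"
    then show "\<exists>y\<in>S. x \<oplus> y = \<zero>"
      using diff_self[OF Sc[OF x]] S_scale[OF x, of "-1"] unfolding bm_diff_def by blast
  next
    show "\<exists>K. \<forall>a. \<forall>x\<in>S. \<nu> (h a \<rhd> x) \<le> K * norm a * \<nu> x"
      using left_bounded bound[of "\<lambda>b x. b \<rhd> x"] Sc by metis
    show "\<exists>K. \<forall>a. \<forall>x\<in>S. \<nu> (x \<lhd> h a) \<le> K * norm a * \<nu> x"
      using right_bounded bound[of "\<lambda>b x. x \<lhd> b"] Sc by metis
  next
    show "x \<oplus> y = y \<oplus> x" if "x \<in> S" "y \<in> S" for x y
      using that Sc by (simp add: add_commute)
  qed (simp_all add: Sc S0 S_add S_scale S_left S_right h.add h.scaleC h.mult add_assoc add_zero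
      scale_add_right scale_add_left scale_scale scale_one norm_eq_zero norm_triangle norm_scale
      left_add left_add' left_scale left_scale' left_mult right_add right_add' right_scale
      right_scale' right_mult left_right)
qed

lemma banach_bimodule_pullback_annihilator:
  fixes h :: "'a::complex_banach_algebra \<Rightarrow> 'b"
  assumes h: "algebra_hom h" and orth: "\<And>a b. b \<in> J \<Longrightarrow> h a * b = 0 \<and> b * h a = 0"
  shows "banach_bimodule (pullback (annihilator J) h)"
proof (rule banach_bimodule_pullback[OF h])
  have zero: "0 \<rhd> x = \<zero>" "x \<lhd> 0 = \<zero>" if "x \<in> bm_carrier E" for x
    using left_scale[OF that, of 0 0] right_scale[OF that, of 0 0] that
    by (simp_all add: scaleC_zero_right scale_zero_left left_closed right_closed)
  show "h a \<rhd> x \<in> annihilator J" if "x \<in> annihilator J" for a x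
    using that orth[of _ a] by (auto simp: annihilator_def left_closed zero simp flip: left_mult left_right)
       (metis zero_actions(1) left_right)
  show "x \<lhd> h a \<in> annihilator J" if "x \<in> annihilator J" for a x
    using that orth[of _ a]
    by (auto simp: annihilator_def right_closed left_right zero zero_actions simp flip: right_mult)
  show "l \<in> annihilator J"
    if "l \<in> bm_carrier E" "\<And>e. e > 0 \<Longrightarrow> \<exists>x\<in>annihilator J. \<nu> (x \<ominus> l) < e" for l
    using that by (rule annihilator_limit)
qed (auto simp: annihilator_def zero_closed zero_actions add_closed scale_closed left_add' right_add'
    add_zero left_scale' right_scale' scale_zero_right)

end

text \<open>
  Induction on the set of ranges.  Let \<open>z\<close> correct \<open>D\<close> on the ranges indexed by \<open>J\<close>, so that
  \<open>D' = D - ad z\<close> vanishes on them.  For \<open>b\<close> in one of these and \<open>c\<close> in the next range, both products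
  of \<open>b\<close> and \<open>c\<close> are zero, and expanding \<open>D' (b c) = 0\<close> and \<open>D' (c b) = 0\<close> leaves \<open>b (D' c) = 0\<close> and
  \<open>(D' c) b = 0\<close>.  Hence \<open>D'\<close> maps the next range into the annihilator, which is a bimodule over the
  copy of \<open>A\<close> there; contractibility of \<open>A\<close> provides a \<open>w\<close> in it, and \<open>z + w\<close> corrects \<open>D\<close> on all
  ranges.
\<close>

lemma (in banach_derivation) derivation_inner_on_orthogonal_images:
  fixes \<theta> :: "'i \<Rightarrow> 'a::complex_banach_algebra \<Rightarrow> 'b"
  assumes A: "contractible_algebra TYPE('a)" and "finite I"
    and \<theta>: "\<And>i. i \<in> I \<Longrightarrow> algebra_hom (\<theta> i)"
    and orth: "\<And>i j a b. \<lbrakk>i \<in> I; j \<in> I; i \<noteq> j\<rbrakk> \<Longrightarrow> \<theta> i a * \<theta> j b = 0"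
  shows "\<exists>z\<in>bm_carrier E. \<forall>i\<in>I. \<forall>a. D (\<theta> i a) = ad z (\<theta> i a)"
  using \<open>finite I\<close> \<theta> orth
proof (induction I rule: finite_induct)
  case empty
  then show ?case using zero_closed by blast
next
  case (insert x J)
  then obtain z where z: "z \<in> bm_carrier E" and ad_z: "\<And>j a. j \<in> J \<Longrightarrow> D (\<theta> j a) = ad z (\<theta> j a)"
    by auto
  interpret \<theta>: algebra_hom "\<theta> x" using insert.prems by simp
  define D' where "D' b = D b \<ominus> ad z b" for b
  define N where "N = annihilator (\<Union>j\<in>J. range (\<theta> j))"
  have "derivation E D'"
    unfolding D'_def by (rule derivation_diff[OF der derivation_ad[OF z]])
  then interpret D': banach_derivation E D' by unfold_locales
  have ad_closed: "ad w b \<in> bm_carrier E" if "w \<in> bm_carrier E" for w b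
    using that by (simp add: diff_closed left_closed right_closed)
  have D'_J: "D' (\<theta> j a) = \<zero>" if "j \<in> J" for j a
    using that ad_z ad_closed[OF z] by (simp add: D'_def diff_self)
  have N: "D' (\<theta> x a) \<in> N" for a
  proof -
    have "\<theta> j b \<rhd> D' (\<theta> x a) = \<zero>" "D' (\<theta> x a) \<lhd> \<theta> j b = \<zero>" if j: "j \<in> J" for j b
    proof -
      have "x \<noteq> j" using insert.hyps(2) j by auto
      then have "\<theta> j b * \<theta> x a = 0" "\<theta> x a * \<theta> j b = 0"
        using insert.prems(2)[of j x b a] insert.prems(2)[of x j a b] j by auto
      then have "(D' (\<theta> j b) \<lhd> \<theta> x a) \<oplus> (\<theta> j b \<rhd> D' (\<theta> x a)) = \<zero>"
          "(D' (\<theta> x a) \<lhd> \<theta> j b) \<oplus> (\<theta> x a \<rhd> D' (\<theta> j b)) = \<zero>"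
        by (metis D'.D_mult D'.D_zero)+
      then show "\<theta> j b \<rhd> D' (\<theta> x a) = \<zero>" "D' (\<theta> x a) \<lhd> \<theta> j b = \<zero>"
        unfolding D'_J[OF j] zero_actions
        by (simp_all add: zero_add add_zero left_closed right_closed D'.D_closed)
    qed
    then show ?thesis by (auto simp: N_def annihilator_def D'.D_closed)
  qed
  have "banach_bimodule (pullback N (\<theta> x))"
    unfolding N_def
  proof (rule banach_bimodule_pullback_annihilator)
    show "algebra_hom (\<theta> x)" by unfold_locales
    show "\<theta> x a * b = 0 \<and> b * \<theta> x a = 0" if "b \<in> (\<Union>j\<in>J. range (\<theta> j))" for a b
      using that insert.hyps(2) insert.prems(2) by auto
  qed
  moreover have "derivation (pullback N (\<theta> x)) (\<lambda>a. D' (\<theta> x a))"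
  proof -
    obtain K where K: "\<And>b. \<nu> (D' b) \<le> K * norm b" using D'.der by (auto simp: derivation_def)
    obtain H where H: "\<And>a. norm (\<theta> x a) \<le> H * norm a" using \<theta>.bounded by blast
    have "\<nu> (D' (\<theta> x a)) \<le> (\<bar>K\<bar> * H) * norm a" for a
    proof -
      have "\<nu> (D' (\<theta> x a)) \<le> K * norm (\<theta> x a)" by (rule K)
      also have "\<dots> \<le> \<bar>K\<bar> * (H * norm a)" by (intro mult_mono H) auto
      finally show ?thesis by (simp add: mult.assoc)
    qed
    then have "\<exists>K. \<forall>a. \<nu> (D' (\<theta> x a)) \<le> K * norm a" by blast
    then show ?thesis
      by (auto simp: derivation_def pullback_def N \<theta>.add \<theta>.scaleC \<theta>.mult D'.D_add D'.D_scale D'.D_mult)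
  qed
  ultimately have "inner_derivation (pullback N (\<theta> x)) (\<lambda>a. D' (\<theta> x a))"
    by (rule contractible_algebra_inner[OF A])
  then obtain w where w: "w \<in> N" "\<And>a. D' (\<theta> x a) = ad w (\<theta> x a)"
    unfolding inner_derivation_def pullback_diff by (auto simp: pullback_def)
  have wc: "w \<in> bm_carrier E" using w(1) by (simp add: N_def annihilator_def)
  have ad_add: "ad (z \<oplus> w) b = ad z b \<oplus> ad w b" for b
    using z wc by (simp add: left_add' right_add' add_diff_add left_closed right_closed)
  have ad_w: "ad w (\<theta> j a) = \<zero>" if "j \<in> J" for j a
    using w(1) that by (auto simp: N_def annihilator_def diff_self zero_closed)
  have "D (\<theta> x a) = ad (z \<oplus> w) (\<theta> x a)" for a
    using diff_add_cancel[OF D_closed ad_closed[OF z], of "\<theta> x a" "\<theta> x a"] w(2)[of a]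
    unfolding D'_def ad_add by (simp add: add_commute[OF ad_closed[OF z] ad_closed[OF wc]])
  moreover have "D (\<theta> j a) = ad (z \<oplus> w) (\<theta> j a)" if "j \<in> J" for j a
    using that by (simp add: ad_add ad_w ad_z add_zero ad_closed z)
  ultimately show ?case
    using add_closed[OF z wc] by (intro bexI[of _ "z \<oplus> w"]) auto
qed

text \<open>
  By additivity, a derivation that is implemented by \<open>z\<close> on each of the ranges is implemented by \<open>z\<close>
  on the sums of their elements.
\<close>

theorem contractible_spanned_by_orthogonal_images:
  fixes \<theta> :: "'i \<Rightarrow> 'a::complex_banach_algebra \<Rightarrow> 'b::complex_banach_algebra"
  assumes A: "contractible_algebra TYPE('a)" and fin: "finite I"
    and \<theta>: "\<And>i. i \<in> I \<Longrightarrow> algebra_hom (\<theta> i)"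
    and orth: "\<And>i j a b. \<lbrakk>i \<in> I; j \<in> I; i \<noteq> j\<rbrakk> \<Longrightarrow> \<theta> i a * \<theta> j b = 0"
    and span: "\<And>b. \<exists>g. b = (\<Sum>i\<in>I. \<theta> i (g i))"
  shows "contractible_algebra TYPE('b)"
  unfolding contractible_algebra_def
proof (intro allI impI)
  fix E :: "('b, 'b bimodule_universe) bimodule" and D
  assume E: "banach_bimodule E" and D: "derivation E D"
  interpret banach_derivation E D
    using E D by (simp add: banach_derivation_def banach_derivation_axioms_def)
  obtain z where z: "z \<in> bm_carrier E" and ad_z: "\<And>i a. i \<in> I \<Longrightarrow> D (\<theta> i a) = ad z (\<theta> i a)"
    using derivation_inner_on_orthogonal_images[of I \<theta>, OF A fin \<theta> orth] by blast
  interpret ad: banach_derivation E "ad z"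
    by unfold_locales (rule derivation_ad[OF z])
  have "D (\<Sum>i\<in>J. \<theta> i (g i)) = ad z (\<Sum>i\<in>J. \<theta> i (g i))" if "J \<subseteq> I" for J g
    using finite_subset[OF that fin] that
  proof (induction J rule: finite_induct)
    case empty
    show ?case by (simp only: sum.empty D_zero ad.D_zero)
  next
    case (insert x J)
    then show ?case by (simp only: sum.insert D_add ad.D_add ad_z insert_subset simp_thms)
  qed
  then have "D b = ad z b" for b
    using span[of b] by auto
  then show "inner_derivation E D"
    unfolding inner_derivation_def using z by blast
qed

corollary contractible_surjective_image:
  fixes h :: "'a::complex_banach_algebra \<Rightarrow> 'b::complex_banach_algebra"
  assumes "contractible_algebra TYPE('a)" "algebra_hom h" "surj h"
  shows "contractible_algebra TYPE('b)"
proof (rule contractible_spanned_by_orthogonal_images[where \<theta>="\<lambda>_. h" and I="{()}"])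
  show "\<exists>g. b = (\<Sum>i\<in>{()}. h (g i))" for b
    using surjD[OF assms(3), of b] by auto
qed (use assms in auto)


section \<open>Second adjoints\<close>

definition dual_map :: "('a::complex_normed_vector \<Rightarrow> 'b::complex_normed_vector) \<Rightarrow> 'b cdual \<Rightarrow> 'a cdual" where
  "dual_map h f = mk_cdual (\<lambda>x. cdual_apply f (h x))"

definition bidual_map :: "('a::complex_normed_algebra \<Rightarrow> 'b::complex_normed_algebra) \<Rightarrow> 'a bidual \<Rightarrow> 'b bidual" where
  "bidual_map h F = Bidual (dual_map (dual_map h) (cdual_of_bidual F))"

abbreviation bidual_apply :: "'a::complex_normed_algebra bidual \<Rightarrow> 'a cdual \<Rightarrow> complex" where
  "bidual_apply F f \<equiv> cdual_apply (cdual_of_bidual F) f"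

lemma cdual_apply_zero_right: "cdual_apply f 0 = 0"
  using cdual_apply_scaleC_right[of f 0 0] by (simp add: scaleC_zero_right)

lemma cdual_apply_sum_right: "cdual_apply f (\<Sum>i\<in>I. g i) = (\<Sum>i\<in>I. cdual_apply f (g i))"
  by (induction I rule: infinite_finite_induct)
     (simp_all add: cdual_apply_zero_right cdual_apply_add_right)

lemma cdual_apply_sum_left: "cdual_apply (\<Sum>i\<in>I. f i) x = (\<Sum>i\<in>I. cdual_apply (f i) x)"
  by (induction I rule: infinite_finite_induct)
     (simp_all add: cdual_apply_zero_left cdual_apply_add_left)

lemma bidual_apply_sum: "bidual_apply (\<Sum>i\<in>I. F i) f = (\<Sum>i\<in>I. bidual_apply (F i) f)"
  by (induction I rule: infinite_finite_induct)
     (simp_all add: cdual_of_bidual_simps cdual_apply_zero_left cdual_apply_add_left)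

lemma bidual_eqI: "(\<And>f. bidual_apply F f = bidual_apply G f) \<Longrightarrow> F = G"
  by (simp add: cdual_eqI flip: cdual_of_bidual_inject)

lemma bidual_apply_times:
  "bidual_apply (F * G) f = bidual_apply F (bidual_act (cdual_of_bidual G) f)"
  by (simp add: cdual_of_bidual_simps arens_apply)

context bounded_clinear
begin

lemma dual_map_apply: "cdual_apply (dual_map h f) x = cdual_apply f (h x)"
  and norm_dual_map_le: "\<exists>K. \<forall>f. norm (dual_map h f) \<le> K * norm f"
proof -
  obtain K0 where "\<And>x. norm (h x) \<le> K0 * norm x" using bounded by blast
  then have K: "norm (h x) \<le> \<bar>K0\<bar> * norm x" for x
    by (meson abs_ge_self mult_right_mono norm_ge_zero order_trans)
  have bound: "norm (cdual_apply f (h x)) \<le> (\<bar>K0\<bar> * norm f) * norm x" for f x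
  proof -
    have "norm (cdual_apply f (h x)) \<le> norm f * norm (h x)" by (rule cdual_apply_bound)
    also have "\<dots> \<le> norm f * (\<bar>K0\<bar> * norm x)" by (intro mult_left_mono K norm_ge_zero)
    finally show ?thesis by (simp add: mult_ac)
  qed
  show app: "cdual_apply (dual_map h f) x = cdual_apply f (h x)" for f x
    unfolding dual_map_def
    by (rule cdual_apply_mk_cdual[where K="\<bar>K0\<bar> * norm f"])
       (simp_all add: add scaleC cdual_apply_add_right cdual_apply_scaleC_right bound)
  have "norm (dual_map h f) \<le> \<bar>K0\<bar> * norm f" for f
    by (rule norm_cdual_bound) (simp_all add: app bound)
  then show "\<exists>K. \<forall>f. norm (dual_map h f) \<le> K * norm f" by blast
qed

lemma bounded_clinear_dual_map: "bounded_clinear (dual_map h)"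
  by (rule bounded_clinear.intro)
     (auto intro!: cdual_eqI norm_dual_map_le
       simp: dual_map_apply cdual_apply_add_left cdual_apply_scaleC_left)

end

lemma bidual_map_apply:
  assumes "bounded_clinear h"
  shows "bidual_apply (bidual_map h F) f = bidual_apply F (dual_map h f)"
proof -
  interpret bounded_clinear "dual_map h"
    by (rule bounded_clinear.bounded_clinear_dual_map[OF assms])
  show ?thesis by (simp add: bidual_map_def Bidual_inverse dual_map_apply)
qed

text \<open>
  The adjoint intertwines each of the three steps in the definition of the Arens product:
  \<open>h\<^sup>* f \<cdot> a = h\<^sup>* (f \<cdot> h a)\<close> and \<open>G \<cdot> h\<^sup>* f = h\<^sup>* (h\<^sup>*\<^sup>* G \<cdot> f)\<close>.
\<close>

lemma (in algebra_hom) algebra_hom_bidual_map: "algebra_hom (bidual_map h)"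
proof -
  interpret dual: bounded_clinear "dual_map h" by (rule bounded_clinear_dual_map)
  have app: "bidual_apply (bidual_map h F) f = bidual_apply F (dual_map h f)" for F f
    by (rule bidual_map_apply) unfold_locales
  have act: "dual_act (dual_map h f) a = dual_map h (dual_act f (h a))" for f a
    by (rule cdual_eqI) (simp add: dual_act_apply dual_map_apply mult)
  have "bidual_act (cdual_of_bidual G) (dual_map h f)
      = dual_map h (bidual_act (cdual_of_bidual (bidual_map h G)) f)" for G f
    by (rule cdual_eqI) (simp add: bidual_act_apply dual_map_apply act app)
  then have "bidual_map h (F * G) = bidual_map h F * bidual_map h G" for F G
    by (intro bidual_eqI) (simp add: app bidual_apply_times)
  moreover have "\<exists>K. \<forall>F. norm (bidual_map h F) \<le> K * norm F"
    using dual.norm_dual_map_le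
    by (auto simp: norm_bidual_def bidual_map_def Bidual_inverse)
  ultimately show ?thesis
    by unfold_locales
       (auto intro!: bidual_eqI
         simp: app cdual_of_bidual_simps cdual_apply_add_left cdual_apply_scaleC_left)
qed

text \<open>
  The same three steps, with \<open>h\<^sup>* (f \<cdot> g a) = 0\<close> at the start.
\<close>

lemma bidual_map_orthogonal:
  assumes g: "bounded_clinear g" and h: "bounded_clinear h" and orth: "\<And>a b. g a * h b = 0"
  shows "bidual_map g F * bidual_map h G = 0"
proof (rule bidual_eqI)
  fix f
  note app = bounded_clinear.dual_map_apply[OF g] bounded_clinear.dual_map_apply[OF h]
  have "dual_map h (dual_act f (g a)) = 0" for a
    by (rule cdual_eqI) (simp add: app dual_act_apply orth cdual_apply_zero_left cdual_apply_zero_right)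
  then have "dual_map g (bidual_act (cdual_of_bidual (bidual_map h G)) f) = 0"
    by (intro cdual_eqI)
       (simp add: app bidual_act_apply bidual_map_apply[OF h] cdual_apply_zero_left cdual_apply_zero_right)
  then show "bidual_apply (bidual_map g F * bidual_map h G) f = bidual_apply 0 f"
    by (simp add: bidual_apply_times bidual_map_apply[OF g] cdual_apply_zero_left
        cdual_apply_zero_right cdual_of_bidual_simps(1))
qed

lemma character_comp:
  assumes "algebra_hom h" "\<phi> \<in> character_space" "\<phi> (h a) \<noteq> 0"
  shows "\<phi> \<circ> h \<in> character_space"
proof -
  interpret algebra_hom h by fact
  show ?thesis using assms(2,3) by (auto simp: character_space_def add scaleC mult)
qed

definition bidual_character :: "('a::complex_normed_algebra \<Rightarrow> complex) \<Rightarrow> 'a bidual \<Rightarrow> complex" where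
  "bidual_character \<phi> F = bidual_apply F (mk_cdual \<phi>)"

lemma mk_cdual_character:
  assumes "\<phi> \<in> character_space"
  shows "cdual_apply (mk_cdual \<phi>) a = \<phi> a"
proof (rule cdual_apply_mk_cdual[where K=1])
  show "norm (\<phi> x) \<le> 1 * norm x" for x using character_norm_le[OF assms, of x] by simp
qed (use assms in \<open>simp_all add: character_space_def\<close>)

text \<open>
  The canonical embedding; it shows below that different characters of the algebra extend to
  different characters of the second dual.
\<close>

definition bidual_of :: "'a::complex_normed_algebra \<Rightarrow> 'a bidual" where
  "bidual_of a = Bidual (mk_cdual (\<lambda>f. cdual_apply f a))"

lemma bidual_apply_bidual_of: "bidual_apply (bidual_of a) f = cdual_apply f a"
  unfolding bidual_of_def Bidual_inverse[OF UNIV_I]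
  by (rule cdual_apply_mk_cdual[where K="norm a"])
     (simp_all add: cdual_apply_add_left cdual_apply_scaleC_left mult.commute[of "norm a"] cdual_apply_bound)

lemma bidual_character_of:
  "\<phi> \<in> character_space \<Longrightarrow> bidual_character \<phi> (bidual_of a) = \<phi> a"
  by (simp add: bidual_character_def bidual_apply_bidual_of mk_cdual_character)

text \<open>
  For a character \<open>\<phi>\<close> one has \<open>\<phi> \<cdot> a = \<phi> a * \<phi>\<close>, hence \<open>G \<cdot> \<phi> = G \<phi> * \<phi>\<close>, hence
  \<open>(F \<box> G) \<phi> = F \<phi> * G \<phi>\<close>.
\<close>

lemma bidual_character:
  assumes "\<phi> \<in> character_space"
  shows "bidual_character \<phi> \<in> character_space"
proof -
  note app = mk_cdual_character[OF assms]
  have "\<phi> (a * b) = \<phi> a * \<phi> b" for a b using assms by (simp add: character_space_def)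
  then have "dual_act (mk_cdual \<phi>) a = \<phi> a *\<^sub>C mk_cdual \<phi>" for a
    by (intro cdual_eqI) (simp add: dual_act_apply app cdual_apply_scaleC_left)
  then have "bidual_act (cdual_of_bidual G) (mk_cdual \<phi>) = bidual_character \<phi> G *\<^sub>C mk_cdual \<phi>" for G
    by (intro cdual_eqI)
       (simp add: bidual_act_apply cdual_apply_scaleC_left cdual_apply_scaleC_right app bidual_character_def)
  then have "bidual_character \<phi> (F * G) = bidual_character \<phi> F * bidual_character \<phi> G" for F G
    by (simp add: bidual_character_def bidual_apply_times cdual_apply_scaleC_right)
  moreover obtain a where "\<phi> a \<noteq> 0" using assms by (auto simp: character_space_def)
  then have "\<exists>F. bidual_character \<phi> F \<noteq> 0"
    using bidual_character_of[OF assms] by metis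
  ultimately show ?thesis
    by (simp add: character_space_def)
       (simp add: bidual_character_def cdual_of_bidual_simps cdual_apply_add_left cdual_apply_scaleC_left)
qed

corollary contractible_bidual_finite_character_space:
  assumes "contractible_algebra TYPE('a::complex_banach_algebra bidual)"
  shows "finite (character_space :: ('a \<Rightarrow> complex) set)"
proof (rule finite_imageD)
  show "finite (bidual_character ` (character_space :: ('a \<Rightarrow> complex) set))"
    using contractible_finite_character_space[OF assms] bidual_character
    by (metis finite_subset image_subsetI)
  show "inj_on bidual_character (character_space :: ('a \<Rightarrow> complex) set)"
  proof (intro inj_onI ext)
    fix \<phi> \<psi> :: "'a \<Rightarrow> complex" and a
    assume "\<phi> \<in> character_space" "\<psi> \<in> character_space" "bidual_character \<phi> = bidual_character \<psi>"
    then show "\<phi> a = \<psi> a" by (metis bidual_character_of)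
  qed
qed


section \<open>Finite powers of an algebra\<close>

text \<open>
  The identities that identify \<open>B\<close> with the power of \<open>A\<close> over \<open>I\<close>.  They only involve compositions,
  products equal to zero and finite sums, so they survive the passage to second adjoints.
\<close>

locale finite_power =
  fixes I :: "'i set"
    and inject :: "'i \<Rightarrow> 'a::complex_banach_algebra \<Rightarrow> 'b::complex_banach_algebra"
    and project :: "'i \<Rightarrow> 'b \<Rightarrow> 'a"
  assumes finite: "finite I" and nonempty: "I \<noteq> {}"
    and hom: "\<And>i. i \<in> I \<Longrightarrow> algebra_hom (inject i)" "\<And>i. i \<in> I \<Longrightarrow> algebra_hom (project i)"
    and project_inject: "\<And>i a. i \<in> I \<Longrightarrow> project i (inject i a) = a"
    and orthogonal: "\<And>i j a b. \<lbrakk>i \<in> I; j \<in> I; i \<noteq> j\<rbrakk> \<Longrightarrow> inject i a * inject j b = 0"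
    and sum_inject: "\<And>b. (\<Sum>i\<in>I. inject i (project i b)) = b"
begin

theorem contractible_iff: "contractible_algebra TYPE('b) \<longleftrightarrow> contractible_algebra TYPE('a)"
proof
  obtain i where i: "i \<in> I" using nonempty by blast
  assume "contractible_algebra TYPE('b)"
  then show "contractible_algebra TYPE('a)"
    by (rule contractible_surjective_image[OF _ hom(2)[OF i]]) (metis project_inject[OF i] surjI)
next
  assume "contractible_algebra TYPE('a)"
  then show "contractible_algebra TYPE('b)"
  proof (rule contractible_spanned_by_orthogonal_images[where \<theta>=inject and I=I])
    show "\<exists>g. b = (\<Sum>i\<in>I. inject i (g i))" for b
      using sum_inject[of b] by metis
  qed (fact finite hom orthogonal)+
qed

lemma bounded_clinear:
  assumes "i \<in> I"
  shows "bounded_clinear (inject i)" "bounded_clinear (project i)"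
  using hom[OF assms] by (auto intro: algebra_hom.axioms(1))

lemmas dual_apply =
  bidual_map_apply[OF bounded_clinear(1)] bidual_map_apply[OF bounded_clinear(2)]
  bounded_clinear.dual_map_apply[OF bounded_clinear(1)]
  bounded_clinear.dual_map_apply[OF bounded_clinear(2)]

lemma finite_power_bidual: "finite_power I (\<lambda>i. bidual_map (inject i)) (\<lambda>i. bidual_map (project i))"
proof (rule finite_power.intro)
  show "finite I" "I \<noteq> {}" by (fact finite nonempty)+
  fix i assume i: "i \<in> I"
  show "algebra_hom (bidual_map (inject i))" "algebra_hom (bidual_map (project i))"
    using hom i by (auto intro: algebra_hom.algebra_hom_bidual_map)
next
  fix i assume i: "i \<in> I"
  have "dual_map (inject i) (dual_map (project i) f) = f" for f
    by (rule cdual_eqI) (simp add: dual_apply i project_inject)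
  then show "bidual_map (project i) (bidual_map (inject i) F) = F" for F
    by (intro bidual_eqI) (simp add: dual_apply i)
  show "bidual_map (inject i) F * bidual_map (inject j) G = 0" if "j \<in> I" "i \<noteq> j" for j F G
    using i that by (intro bidual_map_orthogonal bounded_clinear orthogonal)
next
  have "(\<Sum>i\<in>I. dual_map (project i) (dual_map (inject i) f)) = f" for f
    by (rule cdual_eqI) (simp add: cdual_apply_sum_left dual_apply sum_inject flip: cdual_apply_sum_right)
  then show "(\<Sum>i\<in>I. bidual_map (inject i) (bidual_map (project i) F)) = F" for F
    by (intro bidual_eqI) (simp add: bidual_apply_sum dual_apply flip: cdual_apply_sum_right)
qed

end


section \<open>Algebras of vector-valued functions\<close>

lemma algebra_hom_apply_bcontfun:
  "algebra_hom (\<lambda>f :: 'x::topological_space \<Rightarrow>\<^sub>C 'a::complex_normed_algebra. f x)"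
proof
  have "norm (f x) \<le> 1 * norm f" for f :: "'x \<Rightarrow>\<^sub>C 'a" using norm_bounded[of f x] by simp
  then show "\<exists>K. \<forall>f :: 'x \<Rightarrow>\<^sub>C 'a. norm (apply_bcontfun f x) \<le> K * norm f" by blast
qed simp_all

lemma algebra_hom_bcontfun_of_c0fun:
  "algebra_hom (bcontfun_of_c0fun :: ('x::topological_space, 'a::complex_normed_algebra) c0fun \<Rightarrow> _)"
proof
  show "\<exists>K. \<forall>f :: ('x, 'a) c0fun. norm (bcontfun_of_c0fun f) \<le> K * norm f"
    by (rule exI[of _ 1]) (simp add: norm_c0fun.rep_eq)
qed (simp_all add: plus_c0fun.rep_eq scaleC_c0fun.rep_eq times_c0fun.rep_eq)

lemma algebra_hom_comp:
  assumes "algebra_hom g" "algebra_hom h"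
  shows "algebra_hom (\<lambda>x. g (h x))"
proof -
  interpret g: algebra_hom g by (rule assms)
  interpret h: algebra_hom h by (rule assms)
  obtain K L where K: "\<And>x. norm (g x) \<le> K * norm x" and L: "\<And>x. norm (h x) \<le> L * norm x"
    using g.bounded h.bounded by blast
  have "norm (g (h x)) \<le> (\<bar>K\<bar> * L) * norm x" for x
  proof -
    have "norm (g (h x)) \<le> K * norm (h x)" by (rule K)
    also have "\<dots> \<le> \<bar>K\<bar> * (L * norm x)" by (intro mult_mono L) auto
    finally show ?thesis by (simp add: mult.assoc)
  qed
  then have "\<exists>C. \<forall>x. norm (g (h x)) \<le> C * norm x" by blast
  then show ?thesis
    by unfold_locales (simp_all add: g.add h.add g.scaleC h.scaleC g.mult h.mult)
qed

text \<open>
  Choose an open neighbourhood \<open>U\<close> of \<open>x\<close> inside a compact set.  A continuous function that is 1 at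
  \<open>x\<close> and 0 outside \<open>U - {y}\<close> vanishes outside that compact set, and multiplying it with \<open>a\<close> gives \<open>f\<close>.
\<close>

lemma c0fun_separates:
  fixes x y :: "'x::t2_space" and a :: "'a::real_normed_vector"
  assumes lc: "locally_compact_space (euclidean :: 'x topology)" and ne: "x \<noteq> y"
  shows "\<exists>f :: ('x, 'a) c0fun. bcontfun_of_c0fun f x = a \<and> bcontfun_of_c0fun f y = 0"
proof -
  have "Hausdorff_space (euclidean :: 'x topology)"
    unfolding Hausdorff_space_def disjnt_def
    by (metis hausdorff open_openin)
  then have "completely_regular_space (euclidean :: 'x topology)"
    using lc locally_compact_regular_imp_completely_regular_space by blast
  moreover obtain U K where U: "open U" "x \<in> U" "U \<subseteq> K" and K: "compact K"
    using lc unfolding locally_compact_space_def by (auto dest!: spec[of _ x])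
  have "open (U - {y})" "x \<in> U - {y}" using U ne by auto
  ultimately have "\<exists>u :: 'x \<Rightarrow> real. continuous_on UNIV u \<and> u x = 1 \<and> u ` (UNIV - (U - {y})) \<subseteq> {0}"
    unfolding completely_regular_space_gen_alt'[OF zero_neq_one[symmetric]] by simp
  then obtain u :: "'x \<Rightarrow> real"
    where u: "continuous_on UNIV u" "u x = 1" "u ` (UNIV - (U - {y})) \<subseteq> {0}"
    by blast
  have zero: "u z = 0" if "z \<notin> K" for z using u(3) U(3) that by auto
  have "vanishes_at_infinity (\<lambda>z. u z *\<^sub>R a)"
    unfolding vanishes_at_infinity_def using K zero by (auto intro!: exI[of _ K])
  moreover from this have "(\<lambda>z. u z *\<^sub>R a) \<in> bcontfun"
    by (intro vanishes_at_infinity_bcontfun continuous_intros u(1))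
  ultimately have "bcontfun_of_c0fun (C0fun (Bcontfun (\<lambda>z. u z *\<^sub>R a))) z = u z *\<^sub>R a" for z
    by (simp add: C0fun_inverse Bcontfun_inverse)
  moreover have "u y = 0" using u(3) by auto
  ultimately show ?thesis
    using u(2) by (intro exI[of _ "C0fun (Bcontfun (\<lambda>z. u z *\<^sub>R a))"]) simp
qed

text \<open>
  Composing one character of \<open>A\<close> with the evaluations \<open>e x\<close> gives a character of \<open>B\<close> for each \<open>x\<close>,
  and these are pairwise distinct.
\<close>

lemma finite_domain_of_finite_character_space:
  fixes e :: "'x \<Rightarrow> 'b::complex_banach_algebra \<Rightarrow> 'a::complex_banach_algebra"
  assumes ne: "(character_space :: ('a \<Rightarrow> complex) set) \<noteq> {}"
    and fin: "finite (character_space :: ('b \<Rightarrow> complex) set)"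
    and hom: "\<And>x. algebra_hom (e x)"
    and sep: "\<And>x y a. x \<noteq> y \<Longrightarrow> \<exists>b. e x b = a \<and> e y b = 0"
  shows "finite (UNIV :: 'x set)"
proof (rule ccontr)
  assume inf: "infinite (UNIV :: 'x set)"
  obtain \<phi> :: "'a \<Rightarrow> complex" where \<phi>: "\<phi> \<in> character_space" using ne by blast
  then obtain a where a: "\<phi> a \<noteq> 0" by (auto simp: character_space_def)
  have \<phi>0: "\<phi> 0 = 0" using character_norm_le[OF \<phi>, of 0] by simp
  have "\<phi> \<circ> e x \<in> character_space" for x
  proof -
    obtain y where "x \<noteq> y" using inf by (metis UNIV_eq_I finite.emptyI finite_insert insertCI)
    then obtain b where "e x b = a" using sep by blast
    then show ?thesis using a character_comp[OF hom \<phi>, of x b] by simp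
  qed
  then have "finite (range (\<lambda>x. \<phi> \<circ> e x))"
    by (intro finite_subset[OF _ fin]) auto
  moreover have "inj (\<lambda>x. \<phi> \<circ> e x)"
  proof (rule injI, rule ccontr)
    fix x y assume eq: "\<phi> \<circ> e x = \<phi> \<circ> e y" and "x \<noteq> y"
    then obtain b where "e x b = a" "e y b = 0" using sep by blast
    then show False using fun_cong[OF eq, of b] a \<phi>0 by simp
  qed
  ultimately show False using inf finite_imageD[of "\<lambda>x. \<phi> \<circ> e x" UNIV] by simp
qed

lemma continuous_on_finite_type:
  assumes "finite (UNIV :: 'x::t2_space set)"
  shows "continuous_on UNIV (f :: 'x \<Rightarrow> 'b::topological_space)"
proof -
  have "open S" for S :: "'x set"
    using finite_imp_closed[OF finite_subset[OF subset_UNIV assms], of "- S"]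
    by (simp add: open_closed)
  then show ?thesis by (simp add: continuous_on_open_vimage)
qed

text \<open>
  This function vanishes at infinity and is continuous if \<open>X\<close> is finite, see \<open>point_mass\<close> below; for other \<open>X\<close>
  the definition may denote an arbitrary element.
\<close>

definition point_mass :: "'x::t2_space \<Rightarrow> 'a::real_normed_vector \<Rightarrow> ('x, 'a) c0fun" where
  "point_mass x a = C0fun (Bcontfun (\<lambda>y. if y = x then a else 0))"

lemma point_mass:
  assumes "finite (UNIV :: 'x::t2_space set)"
  shows "bcontfun_of_c0fun (point_mass x a) (y :: 'x) = (if y = x then a else 0)"
proof -
  have "vanishes_at_infinity (\<lambda>y. if y = x then a else 0)"
    unfolding vanishes_at_infinity_def using finite_imp_compact[OF assms]
    by (intro allI impI exI[of _ UNIV]) simp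
  moreover from this have "(\<lambda>y. if y = x then a else 0) \<in> bcontfun"
    by (intro vanishes_at_infinity_bcontfun continuous_on_finite_type assms)
  ultimately show ?thesis
    by (simp add: point_mass_def C0fun_inverse Bcontfun_inverse)
qed

lemma c0fun_eqI: "(\<And>x. bcontfun_of_c0fun f x = bcontfun_of_c0fun g x) \<Longrightarrow> f = g"
  by (metis bcontfun_eqI bcontfun_of_c0fun_inject)

lemma algebra_hom_point_mass:
  assumes fin: "finite (UNIV :: 'x::t2_space set)"
  shows "algebra_hom (point_mass x :: 'a::complex_normed_algebra \<Rightarrow> ('x, 'a) c0fun)"
proof
  note simps = point_mass[OF fin] plus_c0fun.rep_eq scaleC_c0fun.rep_eq times_c0fun.rep_eq
  have "norm (point_mass x a) \<le> 1 * norm a" for a :: 'a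
    unfolding norm_c0fun.rep_eq by (rule norm_bound) (simp add: simps)
  then show "\<exists>K. \<forall>a :: 'a. norm (point_mass x a) \<le> K * norm a" by blast
  show "point_mass x (a + b) = point_mass x a + point_mass x b"
    "point_mass x (c *\<^sub>C a) = c *\<^sub>C point_mass x a"
    "point_mass x (a * b) = point_mass x a * point_mass x b" for a b :: 'a and c
    by (rule c0fun_eqI, simp add: simps scaleC_zero_right)+
qed

lemma apply_bcontfun_sum: "apply_bcontfun (\<Sum>i\<in>I. f i) x = (\<Sum>i\<in>I. apply_bcontfun (f i) x)"
  by (induction I rule: infinite_finite_induct) simp_all

lemma finite_power_bcontfun:
  assumes fin: "finite (UNIV :: 'x::t2_space set)"
  shows "finite_power UNIV (\<lambda>x a. bcontfun_of_c0fun (point_mass x a))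
    (\<lambda>x (f :: 'x \<Rightarrow>\<^sub>C 'a::complex_banach_algebra). f x)"
proof (rule finite_power.intro)
  show "algebra_hom (\<lambda>a :: 'a. bcontfun_of_c0fun (point_mass (x :: 'x) a))" for x
    by (rule algebra_hom_comp[OF algebra_hom_bcontfun_of_c0fun algebra_hom_point_mass[OF fin]])
  show "bcontfun_of_c0fun (point_mass x a) * bcontfun_of_c0fun (point_mass y b) = 0"
    if "x \<noteq> y" for x y :: 'x and a b :: 'a
    using that by (intro bcontfun_eqI) (simp add: point_mass[OF fin])
  show "(\<Sum>x\<in>UNIV. bcontfun_of_c0fun (point_mass x (f x))) = f" for f :: "'x \<Rightarrow>\<^sub>C 'a"
    by (rule bcontfun_eqI) (simp add: apply_bcontfun_sum point_mass[OF fin] sum.delta fin)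
qed (simp_all add: algebra_hom_apply_bcontfun fin point_mass[OF fin])

lemma finite_power_c0fun:
  assumes fin: "finite (UNIV :: 'x::t2_space set)"
  shows "finite_power UNIV point_mass
    (\<lambda>x (f :: ('x, 'a::complex_banach_algebra) c0fun). bcontfun_of_c0fun f x)"
proof (rule finite_power.intro)
  have sum: "bcontfun_of_c0fun (\<Sum>i\<in>I. f i) = (\<Sum>i\<in>I. bcontfun_of_c0fun (f i))"
    for f :: "'x \<Rightarrow> ('x, 'a) c0fun" and I
    by (induction I rule: infinite_finite_induct) (simp_all add: zero_c0fun.rep_eq plus_c0fun.rep_eq)
  show "(\<Sum>x\<in>UNIV. point_mass x (bcontfun_of_c0fun b x)) = b" for b :: "('x, 'a) c0fun"
    by (rule c0fun_eqI) (simp add: sum apply_bcontfun_sum point_mass[OF fin] sum.delta fin)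
  show "point_mass x a * point_mass y b = 0" if "x \<noteq> y" for x y :: 'x and a b :: 'a
    using that by (intro c0fun_eqI) (simp add: point_mass[OF fin] times_c0fun.rep_eq zero_c0fun.rep_eq)
  show "algebra_hom (\<lambda>f :: ('x, 'a) c0fun. bcontfun_of_c0fun f x)" for x
    by (rule algebra_hom_comp[OF algebra_hom_apply_bcontfun algebra_hom_bcontfun_of_c0fun])
qed (simp_all add: algebra_hom_point_mass fin point_mass[OF fin])


section \<open>Contractibility of the function algebras and of their second duals\<close>

theorem theorem3p7:
  assumes "locally_compact_space (euclidean :: 'x::t2_space topology)"
    and "(character_space :: ('a::complex_banach_algebra \<Rightarrow> complex) set) \<noteq> {}"
  shows
    "((contractible_algebra TYPE('x \<Rightarrow>\<^sub>C 'a) \<longleftrightarrow> contractible_algebra TYPE(('x, 'a) c0fun)) \<and>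
      (contractible_algebra TYPE(('x, 'a) c0fun) \<longleftrightarrow>
         finite (UNIV :: 'x set) \<and> contractible_algebra TYPE('a))) \<and>
     ((contractible_algebra TYPE(('x \<Rightarrow>\<^sub>C 'a) bidual) \<longleftrightarrow>
         contractible_algebra TYPE(('x, 'a) c0fun bidual)) \<and>
      (contractible_algebra TYPE(('x, 'a) c0fun bidual) \<longleftrightarrow>
         finite (UNIV :: 'x set) \<and> contractible_algebra TYPE('a bidual)))"
proof (cases "finite (UNIV :: 'x set)")
  case True
  interpret Cb: finite_power UNIV "\<lambda>x a. bcontfun_of_c0fun (point_mass x a)"
    "\<lambda>x (f :: 'x \<Rightarrow>\<^sub>C 'a). f x"
    by (rule finite_power_bcontfun[OF True])
  interpret C0: finite_power UNIV point_mass "\<lambda>x (f :: ('x, 'a) c0fun). bcontfun_of_c0fun f x"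
    by (rule finite_power_c0fun[OF True])
  show ?thesis
    using True Cb.contractible_iff C0.contractible_iff
      finite_power.contractible_iff[OF Cb.finite_power_bidual]
      finite_power.contractible_iff[OF C0.finite_power_bidual]
    by simp
next
  case False
  have sep: "\<exists>f :: ('x, 'a) c0fun. bcontfun_of_c0fun f x = a \<and> bcontfun_of_c0fun f y = 0"
    if "x \<noteq> y" for x y :: 'x and a :: 'a
    by (rule c0fun_separates[OF assms(1) that])
  have "infinite (character_space :: (('x \<Rightarrow>\<^sub>C 'a) \<Rightarrow> complex) set)"
  proof
    assume fin: "finite (character_space :: (('x \<Rightarrow>\<^sub>C 'a) \<Rightarrow> complex) set)"
    have "finite (UNIV :: 'x set)"
    proof (rule finite_domain_of_finite_character_space[OF assms(2) fin])
      show "algebra_hom (\<lambda>f :: 'x \<Rightarrow>\<^sub>C 'a. f x)" for x by (rule algebra_hom_apply_bcontfun)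
      show "\<exists>f :: 'x \<Rightarrow>\<^sub>C 'a. f x = a \<and> f y = 0" if "x \<noteq> y" for x y a
        using sep[OF that] by blast
    qed
    with False show False by blast
  qed
  moreover have "infinite (character_space :: (('x, 'a) c0fun \<Rightarrow> complex) set)"
  proof
    assume fin: "finite (character_space :: (('x, 'a) c0fun \<Rightarrow> complex) set)"
    have "finite (UNIV :: 'x set)"
    proof (rule finite_domain_of_finite_character_space[OF assms(2) fin])
      show "algebra_hom (\<lambda>f :: ('x, 'a) c0fun. bcontfun_of_c0fun f x)" for x
        by (rule algebra_hom_comp[OF algebra_hom_apply_bcontfun algebra_hom_bcontfun_of_c0fun])
    qed (rule sep)
    with False show False by blast
  qed
  ultimately show ?thesis
    using False contractible_finite_character_space[where 'b="'x \<Rightarrow>\<^sub>C 'a"]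
      contractible_finite_character_space[where 'b="('x, 'a) c0fun"]
      contractible_bidual_finite_character_space[where 'a="'x \<Rightarrow>\<^sub>C 'a"]
      contractible_bidual_finite_character_space[where 'a="('x, 'a) c0fun"]
    by blast
qed

end
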